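(* Let $k, n$ be positive integers and let $i$ be an integer. Then $$\tilde{\beta}_i(\mathrm{I}(P_{n,k})) = \begin{cases} 1 & \text{if } i=q(k-1)+k-2 \text{ and } n=q(k+1)+k \text{ for some integer } q\ge 0,\\ 1 & \text{if } i=q(k-1)+k-2 \text{ and } n=(q+1)(k+1) \text{ for some integer } q\ge 0,\\ 0 & \text{otherwise}.\end{cases}$$ If $n > k$, then $$\tilde{\beta}_i(\mathrm{I}(C_{n,k}))= \begin{cases} k & \text{if } i=q(k-1)+k-2 \text{ and } n=(q+1)(k+1) \text{ for some integer } q\ge 0,\\ 1 & \text{if } i=q(k-1)+k+t-3 \text{ and } n=(q+1)(k+1)+t \text{ for some integer } q\ge 0 \text{ and some } t\in\{1,\dots,k\},\\ 0 & \text{otherwise}. \end{cases}$$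
   Context: A hypergraph on a finite vertex set $V$ is a collection of distinct non-empty subsets of $V$, called edges. A set $W\subseteq V$ is independent if it contains no edge; the independence complex $\mathrm{I}(\mathcal{H})$ is the simplicial complex on $V$ whose faces are the independent sets of $\mathcal{H}$. $\tilde{\beta}_i(K)$ is the rank of the $i$-dimensional reduced homology group $\tilde{H}_i(K)$ with $\mathbb{Z}_2$ coefficients; the complex $\{\emptyset\}$ has $\tilde{\beta}_{-1}=1$ and all other reduced Betti numbers zero. $k$-uniform tight path: $P_{n,k}$ is the hypergraph on $\{v_1,\ldots,v_n\}$ with edges $\{v_{i+1},\ldots,v_{i+k}\}$, $0\le i\le n-k$ (no edges if $n<k$). $k$-uniform tight cycle: for $n\ge k+1$, $C_{n,k}$ is the hypergraph on $\mathbb{Z}_n$ with edges $\{i,i+1,\ldots,i+k-1\}$, $0\le i\le n-1$ (addition modulo $n$). *)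

theory Defs
  imports "HOL-Algebra.AbelCoset" "Jordan_Normal_Form.VS_Connect" "HOL-Library.Z2"
begin

section \<open>Hypergraphs and independence complexes\<close>

text \<open>A hypergraph is a pair of a vertex set and a set of edges.\<close>

type_synonym 'a hypergraph = "'a set \<times> 'a set set"

definition is_hypergraph :: "'a hypergraph \<Rightarrow> bool" where
  "is_hypergraph H \<longleftrightarrow> finite (fst H) \<and> (\<forall>e\<in>snd H. e \<noteq> {} \<and> e \<subseteq> fst H)"

definition independent :: "'a hypergraph \<Rightarrow> 'a set \<Rightarrow> bool" where
  "independent H W \<longleftrightarrow> W \<subseteq> fst H \<and> \<not> (\<exists>e\<in>snd H. e \<subseteq> W)"

definition indep_complex :: "'a hypergraph \<Rightarrow> 'a set set" where
  "indep_complex H = {W. independent H W}"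

definition tight_path :: "nat \<Rightarrow> nat \<Rightarrow> nat hypergraph" where
  "tight_path n k = ({1..n}, {{i+1..i+k} |i. i + k \<le> n})"

text \<open>The vertex set \<open>\<int>\<^sub>n\<close> is represented by the residues \<open>0, \<dots>, n - 1\<close>.\<close>

definition tight_cycle :: "nat \<Rightarrow> nat \<Rightarrow> nat hypergraph" where
  "tight_cycle n k = ({0..<n}, {{(i + j) mod n |j. j < k} |i. i < n})"

lemma is_hypergraph_tight_path: "k \<ge> 1 \<Longrightarrow> is_hypergraph (tight_path n k)"
  by (auto simp: is_hypergraph_def tight_path_def)

lemma is_hypergraph_tight_cycle: "k \<ge> 1 \<Longrightarrow> is_hypergraph (tight_cycle n k)"
  by (force simp: is_hypergraph_def tight_cycle_def)


section \<open>Reduced simplicial homology with coefficients in the two-element field\<close>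

text \<open>
  A finite simplicial complex is a finite down-closed family \<open>K\<close> of finite sets. The empty set is
  a face of dimension \<open>-1\<close>, so the chain complex below is the augmented one and
  its homology is reduced homology.
\<close>

definition is_complex :: "'a set set \<Rightarrow> bool" where
  "is_complex K \<longleftrightarrow> finite K \<and> (\<forall>\<sigma>\<in>K. finite \<sigma> \<and> (\<forall>\<tau>. \<tau> \<subseteq> \<sigma> \<longrightarrow> \<tau> \<in> K))"

lemma is_complex_indep_complex: "is_hypergraph H \<Longrightarrow> is_complex (indep_complex H)"
  unfolding is_hypergraph_def is_complex_def indep_complex_def independent_def
  by (auto intro: finite_subset[of _ "Pow (fst H)"] finite_subset[of _ "fst H"]) (meson order_trans)

definition faces :: "'a set set \<Rightarrow> int \<Rightarrow> 'a set set" where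
  "faces K i = {\<sigma>\<in>K. int (card \<sigma>) = i + 1}"

text \<open>
  A chain is given by its coefficients. The record fields \<open>mult\<close> and \<open>one\<close> play no role in a module.
\<close>

definition chain_space :: "'a set set \<Rightarrow> int \<Rightarrow> (bit, 'a set \<Rightarrow> bit) module" where
  "chain_space K i =
    \<lparr>carrier = {c. \<forall>\<sigma>. c \<sigma> \<noteq> 0 \<longrightarrow> \<sigma> \<in> faces K i}, mult = undefined, one = undefined,
     zero = (\<lambda>\<sigma>. 0), add = (\<lambda>c d \<sigma>. c \<sigma> + d \<sigma>), smult = (\<lambda>a c \<sigma>. a * c \<sigma>)\<rparr>"

text \<open>
  The linear extension of \<open>\<sigma> \<mapsto> \<Sum>x\<in>\<sigma>. \<sigma> - {x}\<close>.
\<close>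

definition boundary_map :: "'a set set \<Rightarrow> ('a set \<Rightarrow> bit) \<Rightarrow> ('a set \<Rightarrow> bit)" where
  "boundary_map K c = (\<lambda>\<tau>. \<Sum>\<sigma>\<in>K. \<Sum>x\<in>\<sigma>. if \<tau> = \<sigma> - {x} then c \<sigma> else 0)"

definition cycles :: "'a set set \<Rightarrow> int \<Rightarrow> ('a set \<Rightarrow> bit) set" where
  "cycles K i = {c \<in> carrier (chain_space K i). boundary_map K c = (\<lambda>\<tau>. 0)}"

definition boundaries :: "'a set set \<Rightarrow> int \<Rightarrow> ('a set \<Rightarrow> bit) set" where
  "boundaries K i = boundary_map K ` carrier (chain_space K (i + 1))"

definition quotient_module ::
    "('a, 'b, 'c) module_scheme \<Rightarrow> 'b set \<Rightarrow> ('a, 'b set) module" where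
  "quotient_module M N =
    \<lparr>carrier = a_rcosets\<^bsub>M\<^esub> N, mult = undefined, one = undefined,
     zero = N, add = set_add M, smult = (\<lambda>a X. \<Union>x\<in>X. N +>\<^bsub>M\<^esub> (a \<odot>\<^bsub>M\<^esub> x))\<rparr>"

definition reduced_homology :: "'a set set \<Rightarrow> int \<Rightarrow> (bit, ('a set \<Rightarrow> bit) set) module" where
  "reduced_homology K i =
    quotient_module ((chain_space K i)\<lparr>carrier := cycles K i\<rparr>) (boundaries K i)"

definition reduced_betti :: "'a set set \<Rightarrow> int \<Rightarrow> nat" where
  "reduced_betti K i = vectorspace.dim (class_ring :: bit ring) (reduced_homology K i)"

text \<open>
  The constant \<^const>\<open>vectorspace.dim\<close> is only meaningful on vector spaces; the remaining facts
  show that \<^const>\<open>reduced_homology\<close> is one.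
\<close>

lemma vectorspace_quotient_module:
  assumes V: "vectorspace K V" and N: "submodule K N V"
  shows "vectorspace K (quotient_module V N)"
proof -
  interpret V: vectorspace K V by fact
  interpret N: submodule K N V by fact
  have ab: "abelian_group V" by (rule Module.module.axioms(2)[OF V.module.module_axioms])
  have abm: "abelian_monoid V" by (rule abelian_group.axioms(1)[OF ab])
  have sub: "N \<subseteq> carrier V" by (rule N.subset)
  have neg: "\<ominus>\<^bsub>V\<^esub> x \<in> N" if "x \<in> N" for x
  proof -
    have "\<ominus>\<^bsub>V\<^esub> x = (\<ominus>\<^bsub>K\<^esub> \<one>\<^bsub>K\<^esub>) \<odot>\<^bsub>V\<^esub> x"
      using that sub V.module.smult_l_minus[of "\<one>\<^bsub>K\<^esub>" x] by auto
    then show ?thesis using that by simp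
  qed
  have "subgroup N (add_monoid V)"
    by (rule group.subgroupI[OF abelian_group.a_group[OF ab]])
      (use sub neg N.zero_closed N.m_closed in \<open>auto simp: a_inv_def[symmetric] simp del: N.zero_closed\<close>)
  then interpret S: abelian_subgroup N V
    by (intro abelian_subgroupI3 additive_subgroup.intro ab)
  let ?Q = "quotient_module V N"
  let ?c = "\<lambda>x. N +>\<^bsub>V\<^esub> x"
  have carr: "carrier ?Q = ?c ` carrier V"
    by (auto simp: quotient_module_def A_RCOSETS_def')
  have add: "?c x \<oplus>\<^bsub>?Q\<^esub> ?c y = ?c (x \<oplus>\<^bsub>V\<^esub> y)" if "x \<in> carrier V" "y \<in> carrier V" for x y
    using that by (simp add: quotient_module_def S.a_rcos_sum)
  have zero: "\<zero>\<^bsub>?Q\<^esub> = ?c \<zero>\<^bsub>V\<^esub>"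
    using sub by (simp add: quotient_module_def abelian_group.a_coset_add_zero[OF ab])
  have eqI: "?c y = ?c x" if "x \<in> carrier V" "y \<in> ?c x" for x y
    using that abelian_group.a_repr_independence[OF ab, of y N x] S.a_subgroup by metis
  have smult: "a \<odot>\<^bsub>?Q\<^esub> ?c x = ?c (a \<odot>\<^bsub>V\<^esub> x)" if a: "a \<in> carrier K" and x: "x \<in> carrier V" for a x
  proof -
    have "?c (a \<odot>\<^bsub>V\<^esub> y) = ?c (a \<odot>\<^bsub>V\<^esub> x)" if y: "y \<in> ?c x" for y
    proof -
      obtain h where h: "h \<in> N" "y = h \<oplus>\<^bsub>V\<^esub> x"
        using y by (auto simp: a_r_coset_def')
      have "a \<odot>\<^bsub>V\<^esub> y = a \<odot>\<^bsub>V\<^esub> h \<oplus>\<^bsub>V\<^esub> a \<odot>\<^bsub>V\<^esub> x"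
        using h a x sub by (auto simp: V.module.smult_r_distr)
      then have "a \<odot>\<^bsub>V\<^esub> y \<in> ?c (a \<odot>\<^bsub>V\<^esub> x)"
        using h a by (auto simp: a_r_coset_def')
      then show ?thesis using a x by (intro eqI) auto
    qed
    moreover have "x \<in> ?c x" using x by (rule S.a_rcos_self)
    ultimately have "(\<Union>y\<in>?c x. ?c (a \<odot>\<^bsub>V\<^esub> y)) = ?c (a \<odot>\<^bsub>V\<^esub> x)" by blast
    then show ?thesis by (simp add: quotient_module_def)
  qed
  have "abelian_group ?Q"
  proof (rule abelian_groupI)
    fix X assume "X \<in> carrier ?Q"
    then obtain x where x: "x \<in> carrier V" "X = ?c x" by (auto simp: carr)
    then have "?c (\<ominus>\<^bsub>V\<^esub> x) \<oplus>\<^bsub>?Q\<^esub> X = \<zero>\<^bsub>?Q\<^esub>" "?c (\<ominus>\<^bsub>V\<^esub> x) \<in> carrier ?Q"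
      by (simp_all add: add zero carr abelian_group.l_neg[OF ab] abelian_group.a_inv_closed[OF ab])
    then show "\<exists>Y\<in>carrier ?Q. Y \<oplus>\<^bsub>?Q\<^esub> X = \<zero>\<^bsub>?Q\<^esub>" by blast
  next
    fix X Y assume "X \<in> carrier ?Q" "Y \<in> carrier ?Q"
    then show "X \<oplus>\<^bsub>?Q\<^esub> Y = Y \<oplus>\<^bsub>?Q\<^esub> X"
      by (auto simp: carr add abelian_monoid.a_comm[OF abm])
  qed (auto simp: carr add zero abelian_monoid.a_closed[OF abm] abelian_monoid.a_assoc[OF abm]
      abelian_monoid.zero_closed[OF abm] abelian_monoid.l_zero[OF abm])
  then have "Module.module K ?Q"
    by (rule Module.moduleI[OF V.module.R.is_cring])
      (auto simp: carr add smult V.module.smult_l_distr V.module.smult_r_distr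
        V.module.smult_assoc1)
  then show ?thesis by (intro vectorspace.intro V.field.field_axioms)
qed

lemma module_chain_space: "Module.module (class_ring :: bit ring) (chain_space K i)"
proof (rule Module.moduleI)
  show "cring (class_ring :: bit ring)" by (rule class_cring.is_cring)
  show "abelian_group (chain_space K i)"
  proof (rule abelian_groupI)
    fix c assume "c \<in> carrier (chain_space K i)"
    then show "\<exists>d\<in>carrier (chain_space K i). d \<oplus>\<^bsub>chain_space K i\<^esub> c = \<zero>\<^bsub>chain_space K i\<^esub>"
      by (intro bexI[of _ c]) (auto simp: chain_space_def)
  next
    fix c d assume "c \<in> carrier (chain_space K i)" "d \<in> carrier (chain_space K i)"
    then show "c \<oplus>\<^bsub>chain_space K i\<^esub> d \<in> carrier (chain_space K i)"
      by (auto simp: chain_space_def)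
  qed (auto simp: chain_space_def ac_simps simp del: add_bit_eq_xor)
next
  fix a c assume "c \<in> carrier (chain_space K i)"
  then show "a \<odot>\<^bsub>chain_space K i\<^esub> c \<in> carrier (chain_space K i)"
    by (auto simp: chain_space_def)
qed (auto simp: chain_space_def algebra_simps simp del: add_bit_eq_xor mult_bit_eq_and)

lemma boundary_map_add:
  "boundary_map K (\<lambda>\<sigma>. c \<sigma> + d \<sigma>) = (\<lambda>\<tau>. boundary_map K c \<tau> + boundary_map K d \<tau>)"
  unfolding boundary_map_def sum.distrib[symmetric] by (intro ext sum.cong refl) auto

lemma boundary_map_smult:
  "boundary_map K (\<lambda>\<sigma>. a * c \<sigma>) = (\<lambda>\<tau>. a * boundary_map K c \<tau>)"
  unfolding boundary_map_def sum_distrib_left by (intro ext sum.cong refl) auto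

lemma boundary_map_zero: "boundary_map K (\<lambda>\<sigma>. 0) = (\<lambda>\<tau>. 0)"
  unfolding boundary_map_def by (intro ext sum.neutral ballI) auto

lemma boundary_map_closed:
  assumes K: "is_complex K" and c: "c \<in> carrier (chain_space K (i + 1))"
  shows "boundary_map K c \<in> carrier (chain_space K i)"
proof -
  have "\<tau> \<in> faces K i" if nz: "boundary_map K c \<tau> \<noteq> 0" for \<tau>
  proof -
    obtain \<sigma> where s: "\<sigma> \<in> K" "(\<Sum>x\<in>\<sigma>. if \<tau> = \<sigma> - {x} then c \<sigma> else 0) \<noteq> 0"
      using nz unfolding boundary_map_def by (rule sum.not_neutral_contains_not_neutral)
    obtain x where x: "x \<in> \<sigma>" "(if \<tau> = \<sigma> - {x} then c \<sigma> else 0) \<noteq> 0"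
      using s(2) by (rule sum.not_neutral_contains_not_neutral)
    then have t: "\<tau> = \<sigma> - {x}" and "c \<sigma> \<noteq> 0" by (auto split: if_splits)
    then have "int (card \<sigma>) = i + 2" using c by (auto simp: chain_space_def faces_def)
    moreover have "finite \<sigma>" "\<tau> \<in> K" using K s t unfolding is_complex_def by blast+
    moreover have "card \<sigma> = Suc (card \<tau>)"
      using \<open>finite \<sigma>\<close> x(1) t by (metis card_Suc_Diff1)
    ultimately show ?thesis by (simp add: faces_def)
  qed
  then show ?thesis by (auto simp: chain_space_def)
qed

lemma sum_symmetric_bit:
  fixes f :: "'a \<Rightarrow> 'a \<Rightarrow> bit"
  assumes "finite A" and sym: "\<And>x y. f x y = f y x"
  shows "(\<Sum>x\<in>A. \<Sum>y\<in>A - {x}. f x y) = 0"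
  using assms(1)
proof (induction rule: finite_induct)
  case (insert a A)
  have "(\<Sum>y\<in>insert a A - {x}. f x y) = f x a + (\<Sum>y\<in>A - {x}. f x y)" if "x \<in> A" for x
  proof -
    have "insert a A - {x} = insert a (A - {x})" using that insert by auto
    then show ?thesis using insert by simp
  qed
  moreover have "insert a A - {a} = A" using insert by auto
  ultimately have "(\<Sum>x\<in>insert a A. \<Sum>y\<in>insert a A - {x}. f x y)
      = (\<Sum>y\<in>A. f a y) + ((\<Sum>x\<in>A. f x a) + (\<Sum>x\<in>A. \<Sum>y\<in>A - {x}. f x y))"
    using insert by (simp add: sum.distrib del: add_bit_eq_xor mult_bit_eq_and)
  also have "(\<Sum>x\<in>A. f x a) = (\<Sum>y\<in>A. f a y)" by (simp add: sym[of a])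
  finally show ?case unfolding insert.IH by (cases "\<Sum>y\<in>A. f a y") (auto simp only: add_0_right add_0_left one_add_one bit_2_eq_0)
qed simp

lemma boundary_map_boundary_map:
  assumes K: "is_complex K"
  shows "boundary_map K (boundary_map K c) = (\<lambda>\<rho>. 0)"
proof
  fix \<rho> :: "'a set"
  have fin: "finite K" "\<And>\<sigma>. \<sigma> \<in> K \<Longrightarrow> finite \<sigma>" using K by (auto simp: is_complex_def)
  let ?g = "\<lambda>\<tau>. \<Sum>y\<in>\<tau>. if \<rho> = \<tau> - {y} then 1 else (0::bit)"
  have "boundary_map K (boundary_map K c) \<rho> = (\<Sum>\<tau>\<in>K. ?g \<tau> * boundary_map K c \<tau>)"
    unfolding boundary_map_def[of K "boundary_map K c"] sum_distrib_right
    by (intro sum.cong refl) auto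
  also have "\<dots> = (\<Sum>\<tau>\<in>K. \<Sum>\<sigma>\<in>K. \<Sum>x\<in>\<sigma>. if \<tau> = \<sigma> - {x} then ?g \<tau> * c \<sigma> else 0)"
    unfolding boundary_map_def sum_distrib_left by (intro sum.cong refl) auto
  also have "\<dots> = (\<Sum>\<sigma>\<in>K. \<Sum>\<tau>\<in>K. \<Sum>x\<in>\<sigma>. if \<tau> = \<sigma> - {x} then ?g \<tau> * c \<sigma> else 0)"
    by (rule sum.swap)
  also have "\<dots> = (\<Sum>\<sigma>\<in>K. \<Sum>x\<in>\<sigma>. \<Sum>\<tau>\<in>K. if \<tau> = \<sigma> - {x} then ?g \<tau> * c \<sigma> else 0)"
    by (intro sum.cong refl sum.swap)
  also have "\<dots> = (\<Sum>\<sigma>\<in>K. \<Sum>x\<in>\<sigma>. ?g (\<sigma> - {x}) * c \<sigma>)"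
  proof (intro sum.cong refl)
    fix \<sigma> x assume "\<sigma> \<in> K" "x \<in> \<sigma>"
    then have "\<sigma> - {x} \<in> K" using K unfolding is_complex_def by blast
    then show "(\<Sum>\<tau>\<in>K. if \<tau> = \<sigma> - {x} then ?g \<tau> * c \<sigma> else 0) = ?g (\<sigma> - {x}) * c \<sigma>"
      using fin(1) by (subst sum.delta) auto
  qed
  also have "\<dots> = 0"
  proof (rule sum.neutral, rule ballI)
    fix \<sigma> assume "\<sigma> \<in> K"
    then have "(\<Sum>x\<in>\<sigma>. ?g (\<sigma> - {x})) = 0"
      by (intro sum_symmetric_bit fin) (auto simp: Diff_insert2[symmetric] insert_commute)
    then show "(\<Sum>x\<in>\<sigma>. ?g (\<sigma> - {x}) * c \<sigma>) = 0"
      by (simp only: sum_distrib_right[symmetric] mult_zero_left)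
  qed
  finally show "boundary_map K (boundary_map K c) \<rho> = 0" .
qed

lemma vectorspace_reduced_homology:
  assumes K: "is_complex K"
  shows "vectorspace (class_ring :: bit ring) (reduced_homology K i)"
proof -
  let ?C = "chain_space K i" and ?F = "class_ring :: bit ring"
  interpret C: Module.module ?F ?C by (rule module_chain_space)
  have "v \<oplus>\<^bsub>?C\<^esub> w \<in> cycles K i" if "v \<in> cycles K i" "w \<in> cycles K i" for v w
    using that C.a_closed[of v w]
    by (auto simp: cycles_def chain_space_def boundary_map_add simp del: add_bit_eq_xor mult_bit_eq_and)
  moreover have "a \<odot>\<^bsub>?C\<^esub> v \<in> cycles K i" if "v \<in> cycles K i" for a v
    using that C.smult_closed[of a v]
    by (auto simp: cycles_def chain_space_def boundary_map_smult simp del: add_bit_eq_xor mult_bit_eq_and)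
  moreover have "\<zero>\<^bsub>?C\<^esub> \<in> cycles K i"
    by (simp add: cycles_def chain_space_def boundary_map_zero)
  moreover have "cycles K i \<subseteq> carrier ?C"
    by (auto simp: cycles_def)
  ultimately have "submodule ?F (cycles K i) ?C"
    by (intro submodule.intro[OF module_chain_space])
  then have Z: "Module.module ?F (?C\<lparr>carrier := cycles K i\<rparr>)"
    by (rule C.submodule_is_module)
  have "boundaries K i \<subseteq> cycles K i"
    using boundary_map_closed[OF K] boundary_map_boundary_map[OF K]
    by (auto simp: boundaries_def cycles_def)
  moreover have "boundary_map K (\<lambda>\<sigma>. 0) \<in> boundaries K i"
    unfolding boundaries_def by (rule imageI) (simp add: chain_space_def)
  moreover have "(\<lambda>\<tau>. u \<tau> + v \<tau>) \<in> boundaries K i"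
    if uv: "u \<in> boundaries K i" "v \<in> boundaries K i" for u v
  proof -
    obtain c d where "u = boundary_map K c" "c \<in> carrier (chain_space K (i + 1))"
        "v = boundary_map K d" "d \<in> carrier (chain_space K (i + 1))"
      using uv by (auto simp: boundaries_def)
    then show ?thesis unfolding boundaries_def
      by (intro image_eqI[of _ _ "\<lambda>\<sigma>. c \<sigma> + d \<sigma>"])
        (simp add: boundary_map_add del: add_bit_eq_xor, auto simp: chain_space_def)
  qed
  moreover have "(\<lambda>\<tau>. a * v \<tau>) \<in> boundaries K i" if v: "v \<in> boundaries K i" for a v
  proof -
    obtain c where "v = boundary_map K c" "c \<in> carrier (chain_space K (i + 1))"
      using v by (auto simp: boundaries_def)
    then show ?thesis unfolding boundaries_def
      by (intro image_eqI[of _ _ "\<lambda>\<sigma>. a * c \<sigma>"]) (simp add: boundary_map_smult del: mult_bit_eq_and, auto simp: chain_space_def)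
  qed
  ultimately have "submodule ?F (boundaries K i) (?C\<lparr>carrier := cycles K i\<rparr>)"
    by (intro submodule.intro[OF Z]) (simp_all add: chain_space_def boundary_map_zero)
  then show ?thesis unfolding reduced_homology_def
    by (intro vectorspace_quotient_module vectorspace.intro Z class_field)
qed

end

theory Submission
  imports Defs "HOL-Library.Function_Algebras"
begin

text \<open>
  Over the two-element field Betti numbers can be read off from cardinalities of chain groups, and
  counting in the long exact sequence of a pair of complexes compares \<open>I(V, E)\<close> with
  \<open>I(V, insert e E)\<close>: the faces removed are those containing \<open>e\<close>, and they contribute nothing when
  they are paired off by toggling some vertex \<open>v\<close>. Adding and removing edges in this way
  isolates an edge \<open>{0..<k}\<close> of the path or (for \<open>n \<ge> 2k + 1\<close>) the cycle, after which the complex is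
  the join of the boundary of a simplex with the complex of a path or cycle on \<open>n - k - 1\<close> vertices.
  The remaining cycles with \<open>k < n \<le> 2k\<close> are treated by removing a vertex, whose link has the
  homology of a cycle complex on \<open>n - 1\<close> vertices with windows of length \<open>k - 1\<close>, unless
  \<open>n = k + 2\<close>, where the link is acyclic.
\<close>

section \<open>Relative simplicial homology by counting\<close>

text \<open>The period \<open>k + 1\<close> consists of the \<open>k\<close> vertices of the
  isolated edge and one vertex cut out next to it; the boundary of the simplex on these
  \<open>k\<close> vertices is a sphere of dimension \<open>k - 2\<close>, and joining with it
  raises degrees by \<open>k - 1\<close>. A vertex is cut out by making it a singleton edge. An edge
  \<open>e\<close> is free to come or go when, for some vertex \<open>v\<close> outside
  \<open>e\<close>, every edge through \<open>v\<close> united with \<open>e\<close> contains an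
  edge that avoids \<open>v\<close>. In a cycle the windows across the seam between
  \<open>n - 1\<close> and \<open>0\<close> have to be exchanged for windows that jump over the
  block \<open>{0..k}\<close>; at least \<open>k\<close> vertices must remain beyond the block,
  which is the bound \<open>2 * k + 1 \<le> n\<close>. Below it the window length is lowered
  instead: the link of a vertex lacks some windows of length \<open>k - 1\<close>, and each can be
  added using a vertex two steps away from it. For \<open>n = k + 2\<close> no such vertex exists.
  No maps between homology groups are needed: all that is used of the exact sequence is that the
  rank of the connecting homomorphism is nonnegative and bounded by the Betti numbers of its source
  and target.\<close>

declare add_bit_eq_xor [simp del] mult_bit_eq_and [simp del] minus_bit_def [simp del]

section \<open>Dimensions as logarithms of cardinalities\<close>

text \<open>Coordinates in a basis put the vectors in bijection with the functions from the basis to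
  the field; a finite carrier spans itself, so a finite basis exists.\<close>

lemma (in vectorspace) card_carrier_eq_power_dim:
  assumes K: "finite (carrier K)" and V: "finite (carrier V)"
  shows "card (carrier V) = card (carrier K) ^ dim"
proof -
  have "gen_set (carrier V)"
    using in_own_span[of "carrier V"] span_is_subset2[of "carrier V"] by auto
  then have "fin_dim" using V unfolding fin_dim_def by blast
  then obtain B where B: "finite B" "basis B" using finite_basis_exists by blast
  then have BV: "B \<subseteq> carrier V" by (simp add: basis_def)
  have crit: "\<forall>v. v \<in> carrier V \<longrightarrow> (\<exists>!a. a \<in> B \<rightarrow>\<^sub>E carrier K \<and> lincomb a B = v)"
    using basis_criterion[OF B(1) BV] B(2) by blast
  have closed: "lincomb a B \<in> carrier V" if "a \<in> B \<rightarrow>\<^sub>E carrier K" for a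
    using that BV by (intro lincomb_closed) auto
  have "bij_betw (\<lambda>a. lincomb a B) (B \<rightarrow>\<^sub>E carrier K) (carrier V)"
    unfolding bij_betw_def
  proof
    show "inj_on (\<lambda>a. lincomb a B) (B \<rightarrow>\<^sub>E carrier K)"
      using crit closed unfolding inj_on_def by metis
    show "(\<lambda>a. lincomb a B) ` (B \<rightarrow>\<^sub>E carrier K) = carrier V"
      using crit closed by blast
  qed
  then have "card (carrier V) = card (B \<rightarrow>\<^sub>E carrier K)" by (metis bij_betw_same_card)
  then show ?thesis using B by (simp add: card_funcsetE dim_basis)
qed

text \<open>All fibres over the image are translates of the kernel. \<open>G\<close> is a plain set
  closed under differences in an ambient additive type, so that chains can be handled as
  functions.\<close>

lemma card_image_kernel:
  fixes f :: "'a::ab_group_add \<Rightarrow> 'b::ab_group_add"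
  assumes fin: "finite G" and diff: "\<And>x y. x \<in> G \<Longrightarrow> y \<in> G \<Longrightarrow> x - y \<in> G"
    and f: "\<And>x y. f (x + y) = f x + f y"
  shows "card G = card (f ` G) * card {x \<in> G. f x = 0}"
proof -
  have f_diff: "f (x - y) = f x - f y" for x y
    using f[of "x - y" y] by (simp add: algebra_simps)
  have add: "x + y \<in> G" if "x \<in> G" "y \<in> G" for x y
    using diff[OF that(1) diff[OF diff[OF that(2) that(2)] that(2)]] by simp
  have fibre: "card {x \<in> G. f x = z} = card {x \<in> G. f x = 0}" if z: "z \<in> f ` G" for z
  proof -
    obtain y where y: "y \<in> G" "z = f y" using z by blast
    have "bij_betw (\<lambda>x. x - y) {x \<in> G. f x = z} {x \<in> G. f x = 0}"
      by (rule bij_betwI[where g = "\<lambda>x. x + y"]) (use y diff add in \<open>auto simp: f_diff f\<close>)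
    then show ?thesis by (rule bij_betw_same_card)
  qed
  have "card G = (\<Sum>z\<in>f ` G. card {x \<in> G. f x = z})"
    using sum.image_gen[OF fin, of "\<lambda>_. 1::nat" f] by simp
  also have "\<dots> = (\<Sum>z\<in>f ` G. card {x \<in> G. f x = 0})"
    by (rule sum.cong[OF refl]) (rule fibre)
  finally show ?thesis by simp
qed

section \<open>Relative chains, their ranks and Betti numbers\<close>

text \<open>
  The families of faces considered below are complexes and differences of two complexes; for the
  latter these are the relative chains.
\<close>

definition covers :: "'a set \<Rightarrow> 'a set \<Rightarrow> bool" where
  "covers \<tau> \<sigma> \<longleftrightarrow> \<tau> \<subseteq> \<sigma> \<and> card \<sigma> = Suc (card \<tau>)"

text \<open>Incidence is expressed by inclusion and cardinality instead of removal of a vertex, so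
  it survives every bijection of families that respects these two data, such as
  \<open>insert v\<close>. Faces outside \<open>M\<close> are dropped, which for
  \<open>M = K - L\<close> amounts to dividing out the chains of \<open>L\<close>.\<close>

definition rel_boundary :: "'a set set \<Rightarrow> ('a set \<Rightarrow> bit) \<Rightarrow> 'a set \<Rightarrow> bit" where
  "rel_boundary M c = (\<lambda>\<tau>. if \<tau> \<in> M then \<Sum>\<sigma>\<in>M. if covers \<tau> \<sigma> then c \<sigma> else 0 else 0)"

definition chains :: "'a set set \<Rightarrow> int \<Rightarrow> ('a set \<Rightarrow> bit) set" where
  "chains M i = {c. \<forall>\<sigma>. c \<sigma> \<noteq> 0 \<longrightarrow> \<sigma> \<in> faces M i}"

definition rel_cycles :: "'a set set \<Rightarrow> int \<Rightarrow> ('a set \<Rightarrow> bit) set" where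
  "rel_cycles M i = {c \<in> chains M i. rel_boundary M c = 0}"

definition rank_boundary :: "'a set set \<Rightarrow> int \<Rightarrow> real" where
  "rank_boundary M i = log 2 (card (rel_boundary M ` chains M i))"

text \<open>By rank-nullity the first two terms give the dimension of the cycles, see
  \<open>log_card_rel_cycles\<close>; the last term is the dimension of the boundaries.\<close>

definition betti :: "'a set set \<Rightarrow> int \<Rightarrow> real" where
  "betti M i = card (faces M i) - rank_boundary M i - rank_boundary M (i + 1)"

lemma carrier_chain_space: "carrier (chain_space K i) = chains K i"
  by (simp add: chain_space_def chains_def)

lemma finite_faces: "finite M \<Longrightarrow> finite (faces M i)"
  by (simp add: faces_def)

lemma covers_iff:
  assumes "finite \<sigma>"
  shows "covers \<tau> \<sigma> \<longleftrightarrow> (\<exists>x\<in>\<sigma>. \<tau> = \<sigma> - {x})"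
proof
  assume c: "covers \<tau> \<sigma>"
  then have "card (\<sigma> - \<tau>) = 1"
    using assms card_Diff_subset[of \<tau> \<sigma>] finite_subset[of \<tau> \<sigma>] by (simp add: covers_def)
  then obtain x where "\<sigma> - \<tau> = {x}" by (auto simp: card_1_singleton_iff)
  then show "\<exists>x\<in>\<sigma>. \<tau> = \<sigma> - {x}" using c by (auto simp: covers_def)
next
  assume "\<exists>x\<in>\<sigma>. \<tau> = \<sigma> - {x}"
  then obtain x where x: "x \<in> \<sigma>" "\<tau> = \<sigma> - {x}" by blast
  then show "covers \<tau> \<sigma>" using assms card_Suc_Diff1[of \<sigma> x] by (auto simp: covers_def)
qed

lemma sum_facets_eq:
  assumes "finite \<sigma>"
  shows "(\<Sum>x\<in>\<sigma>. if \<tau> = \<sigma> - {x} then a else 0) = (if covers \<tau> \<sigma> then a else (0::bit))"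
proof (cases "covers \<tau> \<sigma>")
  case True
  then obtain x where x: "x \<in> \<sigma>" "\<tau> = \<sigma> - {x}" using covers_iff[OF assms] by blast
  then have "(\<Sum>y\<in>\<sigma>. if \<tau> = \<sigma> - {y} then a else 0) = (\<Sum>y\<in>\<sigma>. if y = x then a else 0)"
    by (intro sum.cong refl if_cong) auto
  then show ?thesis using x True assms by simp
next
  case False
  then show ?thesis using covers_iff[OF assms] by (auto intro: sum.neutral)
qed

lemma boundary_map_eq_rel_boundary:
  assumes K: "is_complex K"
  shows "boundary_map K c = rel_boundary K c"
proof
  fix \<tau>
  have fin: "finite \<sigma>" if "\<sigma> \<in> K" for \<sigma> using K that by (simp add: is_complex_def)
  have eq: "boundary_map K c \<tau> = (\<Sum>\<sigma>\<in>K. if covers \<tau> \<sigma> then c \<sigma> else 0)"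
    unfolding boundary_map_def by (intro sum.cong refl sum_facets_eq fin)
  have "(\<Sum>\<sigma>\<in>K. if covers \<tau> \<sigma> then c \<sigma> else 0) = 0" if "\<tau> \<notin> K"
  proof (rule sum.neutral, rule ballI)
    fix \<sigma> assume "\<sigma> \<in> K"
    then have "\<not> covers \<tau> \<sigma>" using K that unfolding covers_def is_complex_def by blast
    then show "(if covers \<tau> \<sigma> then c \<sigma> else 0) = 0" by simp
  qed
  then show "boundary_map K c \<tau> = rel_boundary K c \<tau>" by (auto simp: eq rel_boundary_def)
qed

lemma rel_boundary_add: "rel_boundary M (c + d) = rel_boundary M c + rel_boundary M d"
proof
  fix \<tau>
  have "(\<Sum>\<sigma>\<in>M. if covers \<tau> \<sigma> then c \<sigma> + d \<sigma> else 0) =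
    (\<Sum>\<sigma>\<in>M. if covers \<tau> \<sigma> then c \<sigma> else 0) + (\<Sum>\<sigma>\<in>M. if covers \<tau> \<sigma> then d \<sigma> else 0)"
    unfolding sum.distrib[symmetric] by (rule sum.cong) auto
  then show "rel_boundary M (c + d) \<tau> = (rel_boundary M c + rel_boundary M d) \<tau>"
    by (simp add: rel_boundary_def func_plus)
qed

lemma rel_boundary_zero [simp]: "rel_boundary M 0 = 0"
  using rel_boundary_add[of M 0 0] by simp

lemma chains_diff:
  assumes "c \<in> chains M i" "d \<in> chains M i"
  shows "c - d \<in> chains M i"
proof -
  have "\<sigma> \<in> faces M i" if "c \<sigma> - d \<sigma> \<noteq> 0" for \<sigma>
  proof -
    have "c \<sigma> \<noteq> 0 \<or> d \<sigma> \<noteq> 0" using that by (metis diff_self)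
    then show ?thesis using assms unfolding chains_def by blast
  qed
  then show ?thesis unfolding chains_def mem_Collect_eq fun_diff_def by blast
qed

lemma zero_chains [simp]: "0 \<in> chains M i"
  by (simp add: chains_def)

lemma rel_boundary_diff: "rel_boundary M (c - d) = rel_boundary M c - rel_boundary M d"
  using rel_boundary_add[of M "c - d" d] by (simp add: algebra_simps)

lemma rel_boundary_chains:
  assumes c: "c \<in> chains M i"
  shows "rel_boundary M c \<in> chains M (i - 1)"
proof -
  have "\<tau> \<in> faces M (i - 1)" if nz: "rel_boundary M c \<tau> \<noteq> 0" for \<tau>
  proof -
    have t: "\<tau> \<in> M" and "(\<Sum>\<sigma>\<in>M. if covers \<tau> \<sigma> then c \<sigma> else 0) \<noteq> 0"
      using nz by (auto simp: rel_boundary_def split: if_splits)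
    then obtain \<sigma> where "\<sigma> \<in> M" "(if covers \<tau> \<sigma> then c \<sigma> else 0) \<noteq> 0"
      by (elim sum.not_neutral_contains_not_neutral)
    then have "covers \<tau> \<sigma>" "\<sigma> \<in> faces M i" using c by (auto simp: chains_def split: if_splits)
    then show ?thesis using t by (simp add: covers_def faces_def)
  qed
  then show ?thesis by (auto simp: chains_def)
qed

lemma rel_boundary_rel_boundary:
  assumes "is_complex K"
  shows "rel_boundary K (rel_boundary K c) = 0"
  using boundary_map_boundary_map[OF assms, of c]
  by (simp add: boundary_map_eq_rel_boundary[OF assms] zero_fun_def)

lemma chains_bij:
  "bij_betw (\<lambda>c. {\<sigma>. c \<sigma> = 1}) (chains M i) (Pow (faces M i))"
proof (rule bij_betwI[where g = "\<lambda>S \<sigma>. if \<sigma> \<in> S then 1 else 0"])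
  show "(\<lambda>c. {\<sigma>. c \<sigma> = 1}) \<in> chains M i \<rightarrow> Pow (faces M i)"
    by (auto simp: chains_def)
  show "(\<lambda>S \<sigma>. if \<sigma> \<in> S then 1 else 0) \<in> Pow (faces M i) \<rightarrow> chains M i"
    by (auto simp: chains_def split: if_splits)
  show "(\<lambda>\<sigma>. if \<sigma> \<in> {\<sigma>. c \<sigma> = 1} then 1 else 0) = c" if "c \<in> chains M i" for c
    by (rule ext) (auto simp: bit_not_one_iff)
qed auto

lemma finite_chains: "finite M \<Longrightarrow> finite (chains M i)"
  using bij_betw_finite[OF chains_bij, of M i] by (simp add: finite_faces)

lemma card_chains: "finite M \<Longrightarrow> card (chains M i) = 2 ^ card (faces M i)"
  using bij_betw_same_card[OF chains_bij, of M i] by (simp add: card_Pow finite_faces)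

lemma finite_rel_cycles: "finite M \<Longrightarrow> finite (rel_cycles M i)"
  by (simp add: rel_cycles_def finite_chains)

lemma log_card_rel_cycles:
  assumes "finite M"
  shows "log 2 (card (rel_cycles M i)) = card (faces M i) - rank_boundary M i"
proof -
  have "card (chains M i) = card (rel_boundary M ` chains M i) * card (rel_cycles M i)"
    unfolding rel_cycles_def
    by (intro card_image_kernel finite_chains assms chains_diff rel_boundary_add)
  then have "2 ^ card (faces M i) = real (card (rel_boundary M ` chains M i)) * real (card (rel_cycles M i))"
    by (metis card_chains[OF assms] of_nat_mult of_nat_numeral of_nat_power)
  moreover have "card (rel_boundary M ` chains M i) > 0"
    using zero_chains[of M i] by (auto simp: card_gt_0_iff finite_chains assms simp del: zero_chains)
  moreover have "0 \<in> rel_cycles M i" by (simp add: rel_cycles_def)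
  then have "card (rel_cycles M i) > 0" by (auto simp: card_gt_0_iff finite_rel_cycles assms)
  ultimately show ?thesis
    unfolding rank_boundary_def
    using log_mult_pos[of "real (card (rel_boundary M ` chains M i))" "real (card (rel_cycles M i))" 2]
      log_pow_cancel[of 2 "card (faces M i)"] by simp
qed

text \<open>Lagrange's theorem gives the order of the homology group as the number of cycles divided
  by the number of boundaries; as a vector space over two elements it has
  \<open>2 ^ reduced_betti K i\<close> elements. The claim compares logarithms.\<close>

lemma reduced_betti_eq_betti:
  assumes K: "is_complex K"
  shows "reduced_betti K i = betti K i"
proof -
  let ?F = "class_ring :: bit ring" and ?H = "reduced_homology K i"
  let ?Z = "chain_space K i\<lparr>carrier := cycles K i\<rparr>"
  have finK: "finite K" using K by (simp add: is_complex_def)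
  have Z: "cycles K i = rel_cycles K i"
    by (simp add: cycles_def rel_cycles_def carrier_chain_space boundary_map_eq_rel_boundary[OF K]
      zero_fun_def)
  have B: "boundaries K i = rel_boundary K ` chains K (i + 1)"
    by (simp add: boundaries_def carrier_chain_space boundary_map_eq_rel_boundary[OF K] image_def)
  have finZ: "finite (cycles K i)" by (simp add: Z finite_rel_cycles finK)
  have BZ: "boundaries K i \<subseteq> cycles K i"
    using rel_boundary_chains[of _ K "i + 1"] rel_boundary_rel_boundary[OF K]
    by (auto simp: B Z rel_cycles_def)
  have zero: "0 \<in> boundaries K i" unfolding B by (intro image_eqI[of _ _ 0]) auto
  have diffB: "c - d \<in> boundaries K i" if "c \<in> boundaries K i" "d \<in> boundaries K i" for c d
    using that unfolding B by (auto simp: rel_boundary_diff[symmetric] chains_diff)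
  have diffZ: "c - d \<in> cycles K i" if "c \<in> cycles K i" "d \<in> cycles K i" for c d
    using that unfolding Z by (auto simp: rel_cycles_def rel_boundary_diff chains_diff)
  have addZ: "c + d \<in> cycles K i" if "c \<in> cycles K i" "d \<in> cycles K i" for c d
    using diffZ[OF that(1) diffZ[OF diffZ[OF that(2) that(2)] that(2)]] by simp
  have addB: "c + d \<in> boundaries K i" if "c \<in> boundaries K i" "d \<in> boundaries K i" for c d
    using diffB[OF that(1) diffB[OF diffB[OF that(2) that(2)] that(2)]] by simp
  have char2: "c + c = 0" for c :: "'a set \<Rightarrow> bit"
    by (rule ext) simp
  have comp: "x \<otimes>\<^bsub>add_monoid ?Z\<^esub> y = x + y" "\<one>\<^bsub>add_monoid ?Z\<^esub> = 0" "carrier (add_monoid ?Z) = cycles K i"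
    for x y
    by (auto simp: chain_space_def fun_eq_iff)
  have grp: "group (add_monoid ?Z)"
  proof (rule groupI, unfold comp)
    show "0 \<in> cycles K i" using zero BZ by blast
    show "\<exists>y\<in>cycles K i. y + x = 0" if "x \<in> cycles K i" for x
      using that char2 by blast
  qed (auto simp: addZ add.assoc)
  then interpret G: group "add_monoid ?Z" .
  \<comment> \<open>In characteristic two every chain is its own inverse, so closure under inverses
    is immediate.\<close>
  have inv: "inv\<^bsub>add_monoid ?Z\<^esub> c = c" if "c \<in> cycles K i" for c
    using G.inv_equality[of c c] that char2[of c] unfolding comp by simp
  have "subgroup (boundaries K i) (add_monoid ?Z)"
  proof (rule G.subgroupI, unfold comp)
    show "boundaries K i \<subseteq> cycles K i" by (rule BZ)
    show "boundaries K i \<noteq> {}" using zero by blast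
    show "inv\<^bsub>add_monoid ?Z\<^esub> c \<in> boundaries K i" if "c \<in> boundaries K i" for c
      using inv[of c] that BZ by auto
  qed (rule addB)
  then have "card (rcosets\<^bsub>add_monoid ?Z\<^esub> (boundaries K i)) * card (boundaries K i) = card (cycles K i)"
    by (rule G.lagrange[of "boundaries K i", unfolded Coset.order_def comp])
  moreover have carr: "carrier ?H = rcosets\<^bsub>add_monoid ?Z\<^esub> (boundaries K i)"
    by (simp add: reduced_homology_def quotient_module_def A_RCOSETS_def)
  ultimately have prod: "card (carrier ?H) * card (boundaries K i) = card (cycles K i)"
    by simp
  have pos: "card (cycles K i) > 0" using zero BZ finZ by (auto simp: card_gt_0_iff)
  then have "card (carrier ?H) \<noteq> 0" using prod by (intro notI) simp
  then have finH: "finite (carrier ?H)" by (intro card_ge_0_finite) (simp only: neq0_conv)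
  have UNIV_bit: "(UNIV :: bit set) = {0, 1}" using bit_not_one_iff by auto
  have carrF: "carrier ?F = UNIV" by simp
  have finF: "finite (carrier ?F)" and cardF: "card (carrier ?F) = 2"
    unfolding carrF UNIV_bit by simp_all
  have cardH: "card (carrier ?H) = 2 ^ reduced_betti K i"
    unfolding reduced_betti_def cardF[symmetric]
    by (rule vectorspace.card_carrier_eq_power_dim[OF vectorspace_reduced_homology[OF K] finF finH])
  have bpos: "card (boundaries K i) > 0" using zero finite_subset[OF BZ finZ] by (auto simp: card_gt_0_iff)
  have "real (card (cycles K i)) = 2 ^ reduced_betti K i * card (boundaries K i)"
    using prod cardH by (metis of_nat_mult of_nat_numeral of_nat_power)
  then have "log 2 (card (cycles K i)) = reduced_betti K i + log 2 (card (boundaries K i))"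
    using bpos by (simp add: log_mult_pos)
  then show ?thesis
    unfolding Z B betti_def rank_boundary_def[of K "i + 1", symmetric]
    using log_card_rel_cycles[OF finK, of i] by simp
qed

section \<open>The exact sequence of a pair of complexes, by counting\<close>

lemma rel_boundary_outside: "\<tau> \<notin> M \<Longrightarrow> rel_boundary M c \<tau> = 0"
  by (simp add: rel_boundary_def)

lemma chains_outside: "c \<in> chains M i \<Longrightarrow> \<sigma> \<notin> M \<Longrightarrow> c \<sigma> = 0"
  unfolding chains_def faces_def by blast

definition restrict_chain :: "'a set set \<Rightarrow> ('a set \<Rightarrow> bit) \<Rightarrow> 'a set \<Rightarrow> bit" where
  "restrict_chain M c = (\<lambda>\<sigma>. if \<sigma> \<in> M then c \<sigma> else 0)"

lemma restrict_chain_add: "restrict_chain M (c + d) = restrict_chain M c + restrict_chain M d"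
  by (auto simp: restrict_chain_def fun_eq_iff)

lemma log_card_image_kernel:
  fixes f :: "'a::ab_group_add \<Rightarrow> 'b::ab_group_add"
  assumes "finite G" "0 \<in> G" "\<And>x y. x \<in> G \<Longrightarrow> y \<in> G \<Longrightarrow> x - y \<in> G"
    and "\<And>x y. f (x + y) = f x + f y"
  shows "log 2 (card G) = log 2 (card (f ` G)) + log 2 (card {x \<in> G. f x = 0})"
proof -
  have "f 0 = 0" using assms(4)[of 0 0] by simp
  then have "{x \<in> G. f x = 0} \<noteq> {}" using assms(2) by blast
  then have "card {x \<in> G. f x = 0} > 0" using assms(1) by (simp add: card_gt_0_iff)
  moreover have "card (f ` G) > 0" using assms(1,2) by (auto simp: card_gt_0_iff)
  ultimately show ?thesis
    using card_image_kernel[of G f] assms(1,3,4) by (simp add: log_mult_pos)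
qed

lemma log_card_mono:
  assumes "finite T" "S \<subseteq> T" "S \<noteq> {}"
  shows "log 2 (card S) \<le> log 2 (card T)"
  using assms card_mono[of T S] finite_subset[of S T] card_gt_0_iff[of S] by simp

lemma rel_cycles_diff: "c \<in> rel_cycles M i \<Longrightarrow> d \<in> rel_cycles M i \<Longrightarrow> c - d \<in> rel_cycles M i"
  by (simp add: rel_cycles_def chains_diff rel_boundary_diff)

lemma zero_rel_cycles: "0 \<in> rel_cycles M i"
  by (simp add: rel_cycles_def)

lemma chains_mono: "L \<subseteq> K \<Longrightarrow> chains L i \<subseteq> chains K i"
  unfolding chains_def faces_def by blast

locale complex_pair =
  fixes K L :: "'a set set"
  assumes K: "is_complex K" and L: "is_complex L" and LK: "L \<subseteq> K"
begin

lemma finite_K: "finite K" and finite_L: "finite L" and finite_KL: "finite (K - L)"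
  using K L by (auto simp: is_complex_def)

lemma not_covers: "\<sigma> \<in> L \<Longrightarrow> \<tau> \<notin> L \<Longrightarrow> \<not> covers \<tau> \<sigma>"
  using L unfolding covers_def is_complex_def by blast

lemma restrict_chains: "c \<in> chains K i \<Longrightarrow> restrict_chain (K - L) c \<in> chains (K - L) i"
  by (auto simp: chains_def faces_def restrict_chain_def split: if_splits)

lemma restrict_chain_idem: "c \<in> chains (K - L) i \<Longrightarrow> restrict_chain (K - L) c = c"
  by (auto simp: fun_eq_iff restrict_chain_def chains_outside)

lemma restrict_eq_0_iff:
  assumes "c \<in> chains K i"
  shows "restrict_chain (K - L) c = 0 \<longleftrightarrow> c \<in> chains L i"
proof
  assume eq: "restrict_chain (K - L) c = 0"
  have "\<sigma> \<in> faces L i" if nz: "c \<sigma> \<noteq> 0" for \<sigma>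
  proof -
    have "\<sigma> \<in> faces K i" using assms nz unfolding chains_def by blast
    moreover have "\<sigma> \<in> L"
      using fun_cong[OF eq, of \<sigma>] nz \<open>\<sigma> \<in> faces K i\<close>
      by (cases "\<sigma> \<in> L") (auto simp: restrict_chain_def faces_def)
    ultimately show ?thesis by (simp add: faces_def)
  qed
  then show "c \<in> chains L i" unfolding chains_def by blast
next
  assume "c \<in> chains L i"
  then show "restrict_chain (K - L) c = 0"
    by (auto simp: fun_eq_iff restrict_chain_def chains_outside)
qed

text \<open>A face outside the down-closed \<open>L\<close> is never a facet of a face of
  \<open>L\<close>, so faces of \<open>L\<close> contribute nothing: restriction is a chain map to
  the relative chains.\<close>

lemma restrict_rel_boundary:
  "restrict_chain (K - L) (rel_boundary K c) = rel_boundary (K - L) (restrict_chain (K - L) c)"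
proof
  fix \<tau>
  have "(\<Sum>\<sigma>\<in>K. if covers \<tau> \<sigma> then c \<sigma> else 0)
      = (\<Sum>\<sigma>\<in>K - L. if covers \<tau> \<sigma> then restrict_chain (K - L) c \<sigma> else 0)" if "\<tau> \<in> K - L"
    by (rule sum.mono_neutral_cong_right) (use that finite_K not_covers in \<open>auto simp: restrict_chain_def\<close>)
  then show "restrict_chain (K - L) (rel_boundary K c) \<tau>
      = rel_boundary (K - L) (restrict_chain (K - L) c) \<tau>"
    unfolding restrict_chain_def[of _ "rel_boundary K c"] unfolding rel_boundary_def by auto
qed

lemma rel_boundary_sub:
  assumes c: "c \<in> chains L i"
  shows "rel_boundary K c = rel_boundary L c"
proof
  fix \<tau>
  have eq: "(\<Sum>\<sigma>\<in>K. if covers \<tau> \<sigma> then c \<sigma> else 0) = (\<Sum>\<sigma>\<in>L. if covers \<tau> \<sigma> then c \<sigma> else 0)"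
    by (rule sum.mono_neutral_right) (use finite_K LK chains_outside[OF c] in auto)
  have "(\<Sum>\<sigma>\<in>L. if covers \<tau> \<sigma> then c \<sigma> else 0) = 0" if "\<tau> \<notin> L"
    by (rule sum.neutral) (use not_covers that in auto)
  then show "rel_boundary K c \<tau> = rel_boundary L c \<tau>"
    using LK by (auto simp: rel_boundary_def eq)
qed

lemma card_faces: "card (faces K i) = card (faces L i) + card (faces (K - L) i)"
proof -
  have "faces K i = faces L i \<union> faces (K - L) i" "faces L i \<inter> faces (K - L) i = {}"
    using LK by (auto simp: faces_def)
  then show ?thesis by (simp add: card_Un_disjoint finite_faces finite_K finite_L)
qed

text \<open>The rank of the connecting homomorphism from relative homology in degree
  \<open>i\<close> to the homology of \<open>L\<close> in degree \<open>i - 1\<close>. The boundary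
  matrix of \<open>K\<close> is block triangular with respect to \<open>L\<close> and
  \<open>K - L\<close>, and this is the excess of its rank over the ranks of the diagonal
  blocks.\<close>

definition connecting_rank :: "int \<Rightarrow> real" where
  "connecting_rank i = rank_boundary K i - rank_boundary L i - rank_boundary (K - L) i"

lemma betti_eq:
  "betti K i = betti L i + betti (K - L) i - connecting_rank i - connecting_rank (i + 1)"
  by (simp add: betti_def connecting_rank_def card_faces)

text \<open>
  The boundaries of those chains of \<open>K\<close> that are cycles relative to \<open>L\<close>; modulo the boundaries of
  \<open>L\<close> this is the image of the connecting homomorphism.
\<close>

definition linking :: "int \<Rightarrow> ('a set \<Rightarrow> bit) set" where
  "linking i = {y \<in> rel_boundary K ` chains K i. restrict_chain (K - L) y = 0}"

lemma finite_linking: "finite (linking i)"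
  by (simp add: linking_def finite_chains finite_K)

text \<open>Rank-nullity for the restriction of boundaries of \<open>K\<close> to
  \<open>K - L\<close>: the image consists of the relative boundaries, the kernel is
  \<open>linking i\<close>.\<close>

lemma log_card_linking: "log 2 (card (linking i)) = connecting_rank i + rank_boundary L i"
proof -
  have "restrict_chain (K - L) ` rel_boundary K ` chains K i = rel_boundary (K - L) ` chains (K - L) i"
  proof (intro equalityI subsetI)
    fix y assume "y \<in> rel_boundary (K - L) ` chains (K - L) i"
    then obtain c where c: "c \<in> chains (K - L) i" "y = rel_boundary (K - L) c" by blast
    then have "y = restrict_chain (K - L) (rel_boundary K c)"
      by (simp add: restrict_rel_boundary restrict_chain_idem)
    moreover have "c \<in> chains K i" using c chains_mono[of "K - L" K] by blast
    ultimately show "y \<in> restrict_chain (K - L) ` rel_boundary K ` chains K i" by blast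
  qed (auto simp: restrict_rel_boundary restrict_chains)
  moreover have "log 2 (card (rel_boundary K ` chains K i))
      = log 2 (card (restrict_chain (K - L) ` rel_boundary K ` chains K i)) + log 2 (card (linking i))"
    unfolding linking_def
  proof (rule log_card_image_kernel)
    show "finite (rel_boundary K ` chains K i)" by (simp add: finite_chains finite_K)
    show "0 \<in> rel_boundary K ` chains K i" by (rule image_eqI[of _ _ 0]) simp_all
    show "x - y \<in> rel_boundary K ` chains K i"
      if "x \<in> rel_boundary K ` chains K i" "y \<in> rel_boundary K ` chains K i" for x y
      using that by (auto simp: rel_boundary_diff[symmetric] chains_diff)
  qed (rule restrict_chain_add)
  ultimately show ?thesis by (simp add: connecting_rank_def rank_boundary_def)
qed

lemma connecting_rank_nonneg: "0 \<le> connecting_rank i"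
proof -
  have "rel_boundary L ` chains L i \<subseteq> linking i"
  proof
    fix y assume "y \<in> rel_boundary L ` chains L i"
    then obtain c where c: "c \<in> chains L i" "y = rel_boundary L c" by blast
    moreover have "c \<in> chains K i" using c(1) chains_mono[OF LK] by blast
    moreover have "y \<in> chains L (i - 1)" using c rel_boundary_chains by blast
    then have "restrict_chain (K - L) y = 0"
      by (auto simp: fun_eq_iff restrict_chain_def chains_outside)
    ultimately show "y \<in> linking i"
      unfolding linking_def using rel_boundary_sub[OF c(1)] image_eqI[of y "rel_boundary K" c "chains K i"]
      by simp
  qed
  moreover have "rel_boundary L ` chains L i \<noteq> {}"
    using zero_chains[of L i] by blast
  ultimately have "rank_boundary L i \<le> log 2 (card (linking i))"
    unfolding rank_boundary_def by (intro log_card_mono finite_linking)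
  then show ?thesis by (simp add: log_card_linking)
qed

text \<open>Elements of \<open>linking i\<close> are cycles of \<open>L\<close>, so modulo
  boundaries of \<open>L\<close> they account for at most its homology in degree
  \<open>i - 1\<close>.\<close>

lemma connecting_rank_le_sub: "connecting_rank i \<le> betti L (i - 1)"
proof -
  have "linking i \<subseteq> rel_cycles L (i - 1)"
  proof
    fix y assume "y \<in> linking i"
    then obtain c where c: "c \<in> chains K i" "y = rel_boundary K c" "restrict_chain (K - L) y = 0"
      unfolding linking_def by blast
    then have y: "y \<in> chains L (i - 1)"
      using restrict_eq_0_iff rel_boundary_chains by blast
    have "rel_boundary L y = 0"
      using rel_boundary_sub[OF y] rel_boundary_rel_boundary[OF K, of c] c(2) by simp
    then show "y \<in> rel_cycles L (i - 1)" using y by (simp add: rel_cycles_def)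
  qed
  moreover have "0 \<in> linking i"
    unfolding linking_def by (auto simp: restrict_chain_def fun_eq_iff intro!: image_eqI[of _ _ 0])
  ultimately have "log 2 (card (linking i)) \<le> log 2 (card (rel_cycles L (i - 1)))"
    by (intro log_card_mono finite_rel_cycles finite_L) auto
  then show ?thesis
    by (simp add: log_card_linking log_card_rel_cycles finite_L betti_def)
qed

text \<open>Restricting the cycles of \<open>K\<close> has the cycles of \<open>L\<close> as kernel,
  and the image contains all relative boundaries. The dimension of the image is thus at least
  \<open>rank_boundary (K - L) (i + 1)\<close>, which rearranges to the claim.\<close>

lemma connecting_rank_le_rel: "connecting_rank i \<le> betti (K - L) i"
proof -
  have "log 2 (card (rel_cycles K i)) = log 2 (card (restrict_chain (K - L) ` rel_cycles K i))
      + log 2 (card {c \<in> rel_cycles K i. restrict_chain (K - L) c = 0})"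
    by (intro log_card_image_kernel finite_rel_cycles finite_K rel_cycles_diff zero_rel_cycles
      restrict_chain_add)
  moreover have "{c \<in> rel_cycles K i. restrict_chain (K - L) c = 0} = rel_cycles L i"
    using restrict_eq_0_iff rel_boundary_sub chains_mono[OF LK, of i]
    unfolding rel_cycles_def by auto
  moreover have "rel_boundary (K - L) ` chains (K - L) (i + 1) \<subseteq> restrict_chain (K - L) ` rel_cycles K i"
  proof
    fix y assume "y \<in> rel_boundary (K - L) ` chains (K - L) (i + 1)"
    then obtain c where c: "c \<in> chains (K - L) (i + 1)" "y = rel_boundary (K - L) c" by blast
    then have "y = restrict_chain (K - L) (rel_boundary K c)"
      by (simp add: restrict_rel_boundary restrict_chain_idem)
    moreover have "c \<in> chains K (i + 1)" using c chains_mono[of "K - L" K] by blast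
    then have "rel_boundary K c \<in> rel_cycles K i"
      using rel_boundary_chains[of c K "i + 1"] rel_boundary_rel_boundary[OF K]
      by (simp add: rel_cycles_def)
    ultimately show "y \<in> restrict_chain (K - L) ` rel_cycles K i" by blast
  qed
  moreover have "rel_boundary (K - L) ` chains (K - L) (i + 1) \<noteq> {}"
    using zero_chains[of "K - L" "i + 1"] by blast
  ultimately have "rank_boundary (K - L) (i + 1) \<le> log 2 (card (rel_cycles K i)) - log 2 (card (rel_cycles L i))"
    unfolding rank_boundary_def
    using log_card_mono[of "restrict_chain (K - L) ` rel_cycles K i"
        "rel_boundary (K - L) ` chains (K - L) (i + 1)"] finite_rel_cycles[OF finite_K]
    by simp
  then show ?thesis
    by (simp add: log_card_rel_cycles finite_K finite_L betti_def connecting_rank_def card_faces)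
qed

lemma rel_boundary_twice:
  assumes c: "c \<in> chains (K - L) i"
  shows "rel_boundary (K - L) (rel_boundary (K - L) c) = 0"
proof -
  have "rel_boundary (K - L) c = restrict_chain (K - L) (rel_boundary K c)"
    by (simp add: restrict_rel_boundary restrict_chain_idem[OF c])
  then have "rel_boundary (K - L) (rel_boundary (K - L) c) = restrict_chain (K - L) 0"
    by (simp add: restrict_rel_boundary[symmetric] rel_boundary_rel_boundary[OF K])
  then show ?thesis by (simp add: restrict_chain_def fun_eq_iff)
qed

text \<open>
  A cycle \<open>z\<close> is the boundary of the chain \<open>\<sigma> \<mapsto> z (\<sigma> - {v})\<close> supported on the faces containing \<open>v\<close>.
\<close>

lemma betti_rel_toggle:
  assumes toggle: "\<And>\<sigma>. v \<notin> \<sigma> \<Longrightarrow> \<sigma> \<in> K - L \<longleftrightarrow> insert v \<sigma> \<in> K - L"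
  shows "betti (K - L) i = 0"
proof -
  let ?M = "K - L"
  have finf: "finite \<sigma>" if "\<sigma> \<in> ?M" for \<sigma>
    using K that by (auto simp: is_complex_def)
  have "z \<in> rel_boundary ?M ` chains ?M (i + 1)" if z: "z \<in> rel_cycles ?M i" for z
  proof -
    define w where "w = (\<lambda>\<sigma>. if v \<in> \<sigma> then z (\<sigma> - {v}) else 0)"
    have zc: "z \<in> chains ?M i" and zb: "rel_boundary ?M z = 0"
      using z by (auto simp: rel_cycles_def)
    have "\<sigma> \<in> faces ?M (i + 1)" if "w \<sigma> \<noteq> 0" for \<sigma>
    proof -
      have v: "v \<in> \<sigma>" "z (\<sigma> - {v}) \<noteq> 0" using that by (auto simp: w_def split: if_splits)
      then have f: "\<sigma> - {v} \<in> faces ?M i" using zc unfolding chains_def by blast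
      then have "\<sigma> \<in> ?M" using toggle[of "\<sigma> - {v}"] v(1) by (simp add: faces_def insert_absorb)
      then show ?thesis using f v(1) card_Suc_Diff1[OF finf v(1)] by (simp add: faces_def)
    qed
    then have wc: "w \<in> chains ?M (i + 1)" unfolding chains_def by blast
    have "rel_boundary ?M w \<tau> = z \<tau>" for \<tau>
    proof (cases "\<tau> \<in> ?M")
      case False
      then show ?thesis using chains_outside[OF zc False] rel_boundary_outside[OF False] by simp
    next
      case tM: True
      show ?thesis
      proof (cases "v \<in> \<tau>")
        case False
        \<comment> \<open>Of the faces covering \<open>\<tau>\<close> only
          \<open>insert v \<tau>\<close> contains \<open>v\<close>, and \<open>w\<close> vanishes on
          the others.\<close>
        have iM: "insert v \<tau> \<in> ?M" using toggle False tM by blast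
        have cov: "covers \<tau> (insert v \<tau>)"
          using False finf[OF tM] by (simp add: covers_def subset_insertI)
        have uniq: "\<sigma> = insert v \<tau>" if "\<sigma> \<in> ?M" "covers \<tau> \<sigma>" "v \<in> \<sigma>" for \<sigma>
          using covers_iff[OF finf[OF that(1)], of \<tau>] that False by auto
        have "(if covers \<tau> \<sigma> then w \<sigma> else 0) = (if \<sigma> = insert v \<tau> then z \<tau> else 0)"
          if "\<sigma> \<in> ?M" for \<sigma>
        proof (cases "\<sigma> = insert v \<tau>")
          case True
          then show ?thesis using cov False by (simp add: w_def)
        next
          case False
          then have "\<not> covers \<tau> \<sigma> \<or> v \<notin> \<sigma>" using uniq[OF that] by blast
          then show ?thesis using False by (auto simp: w_def)
        qed
        then have "(\<Sum>\<sigma>\<in>?M. if covers \<tau> \<sigma> then w \<sigma> else 0)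
            = (\<Sum>\<sigma>\<in>?M. if \<sigma> = insert v \<tau> then z \<tau> else 0)"
          by (rule sum.cong[OF refl])
        also have "\<dots> = z \<tau>" using iM finite_KL by (subst sum.delta) auto
        finally show ?thesis using tM by (simp add: rel_boundary_def)
      next
        case True
        \<comment> \<open>All faces covering \<open>\<tau>\<close> contain \<open>v\<close>.
          Removing \<open>v\<close> matches them with the faces covering \<open>?\<rho>\<close>
          other than \<open>\<tau>\<close> itself, and since \<open>z\<close> is a cycle its values
          there add up to \<open>z \<tau>\<close>.\<close>
        let ?\<rho> = "\<tau> - {v}"
        have r: "?\<rho> \<in> ?M" using toggle[of ?\<rho>] tM True by (simp add: insert_absorb)
        have fint: "finite \<tau>" using finf tM by blast
        have cov: "covers ?\<rho> \<tau>" using True unfolding covers_iff[OF fint] by blast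
        have eq: "(\<Sum>\<sigma>\<in>?M. if covers \<tau> \<sigma> then w \<sigma> else 0)
            = (\<Sum>\<sigma>\<in>?M - {\<tau>}. if covers ?\<rho> \<sigma> then z \<sigma> else 0)"
          unfolding sum.inter_filter[OF finite_KL, symmetric]
            sum.inter_filter[OF finite_Diff[OF finite_KL], symmetric]
        proof (rule sum.reindex_bij_witness[where i = "insert v" and j = "\<lambda>\<sigma>. \<sigma> - {v}"])
          fix \<sigma> assume "\<sigma> \<in> {\<sigma> \<in> ?M. covers \<tau> \<sigma>}"
          then have s: "\<sigma> \<in> ?M" "covers \<tau> \<sigma>" by auto
          then obtain x where x: "x \<in> \<sigma>" "\<tau> = \<sigma> - {x}"
            using covers_iff[OF finf[OF s(1)], of \<tau>] by blast
          have v: "v \<in> \<sigma>" using True x by blast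
          show "insert v (\<sigma> - {v}) = \<sigma>" using v by blast
          have "\<sigma> - {v} \<in> ?M" using toggle[of "\<sigma> - {v}"] s(1) v by (simp add: insert_absorb)
          moreover have "covers ?\<rho> (\<sigma> - {v})"
            using x True finf[OF s(1)] by (subst covers_iff) auto
          moreover have "\<sigma> - {v} \<noteq> \<tau>" using True by blast
          ultimately show "\<sigma> - {v} \<in> {\<sigma> \<in> ?M - {\<tau>}. covers ?\<rho> \<sigma>}" by blast
          show "z (\<sigma> - {v}) = w \<sigma>" using v by (simp add: w_def)
        next
          fix \<sigma> assume "\<sigma> \<in> {\<sigma> \<in> ?M - {\<tau>}. covers ?\<rho> \<sigma>}"
          then have s: "\<sigma> \<in> ?M" "\<sigma> \<noteq> \<tau>" "covers ?\<rho> \<sigma>" by auto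
          then obtain x where x: "x \<in> \<sigma>" "?\<rho> = \<sigma> - {x}"
            using covers_iff[OF finf[OF s(1)], of ?\<rho>] by blast
          have v: "v \<notin> \<sigma>" using x s(2) True by blast
          then show "insert v \<sigma> - {v} = \<sigma>" by blast
          have "insert v \<sigma> \<in> ?M" using toggle s(1) v by blast
          moreover have "\<exists>x\<in>insert v \<sigma>. \<tau> = insert v \<sigma> - {x}"
            using x v True by (intro bexI[of _ x]) auto
          then have "covers \<tau> (insert v \<sigma>)" using finf[OF s(1)] by (subst covers_iff) auto
          ultimately show "insert v \<sigma> \<in> {\<sigma> \<in> ?M. covers \<tau> \<sigma>}" by blast
        qed
        have "0 = (\<Sum>\<sigma>\<in>?M. if covers ?\<rho> \<sigma> then z \<sigma> else 0)"
          using fun_cong[OF zb, of ?\<rho>] r by (simp add: rel_boundary_def)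
        also have "\<dots> = z \<tau> + (\<Sum>\<sigma>\<in>?M - {\<tau>}. if covers ?\<rho> \<sigma> then z \<sigma> else 0)"
          using sum.remove[OF finite_KL tM, of "\<lambda>\<sigma>. if covers ?\<rho> \<sigma> then z \<sigma> else 0"] cov by simp
        finally have "(\<Sum>\<sigma>\<in>?M - {\<tau>}. if covers ?\<rho> \<sigma> then z \<sigma> else 0) = z \<tau>"
          by (cases "z \<tau>"; cases "\<Sum>\<sigma>\<in>?M - {\<tau>}. if covers ?\<rho> \<sigma> then z \<sigma> else 0") simp_all
        then show ?thesis using tM eq by (simp add: rel_boundary_def)
      qed
    qed
    then have "z = rel_boundary ?M w" by auto
    then show ?thesis using wc by blast
  qed
  moreover have "rel_boundary ?M ` chains ?M (i + 1) \<subseteq> rel_cycles ?M i"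
    using rel_boundary_chains[of _ ?M "i + 1"] rel_boundary_twice
    by (auto simp: rel_cycles_def)
  ultimately have "rel_boundary ?M ` chains ?M (i + 1) = rel_cycles ?M i" by blast
  then have "rank_boundary ?M (i + 1) = log 2 (card (rel_cycles ?M i))"
    unfolding rank_boundary_def by simp
  then show ?thesis by (simp add: betti_def log_card_rel_cycles finite_KL)
qed

lemma betti_eq_sub:
  assumes "\<And>i. betti (K - L) i = 0"
  shows "betti K i = betti L i"
  using betti_eq[of i] connecting_rank_nonneg connecting_rank_le_rel assms
  by (smt (verit))

lemma betti_eq_rel:
  assumes "\<And>i. betti L i = 0"
  shows "betti K i = betti (K - L) i"
  using betti_eq[of i] connecting_rank_nonneg connecting_rank_le_sub assms
  by (smt (verit))

text \<open>For acyclic \<open>K\<close>, \<open>betti_eq\<close> writes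
  \<open>betti L i + betti (K - L) i\<close> as a sum of two connecting ranks, each bounded by one
  of the summands. All bounds are therefore attained, and \<open>connecting_rank (i + 1)\<close>
  equals both sides of the claim.\<close>

lemma betti_sub_eq_rel:
  assumes "\<And>i. betti K i = 0"
  shows "betti L i = betti (K - L) (i + 1)"
proof -
  have "connecting_rank (i + 1) \<le> betti L i" "connecting_rank (i + 1 + 1) \<le> betti L (i + 1)"
    using connecting_rank_le_sub[of "i + 1"] connecting_rank_le_sub[of "i + 1 + 1"]
    by (simp_all only: add_diff_cancel_right')
  then show ?thesis
    using betti_eq[of i] betti_eq[of "i + 1"] connecting_rank_le_rel[of i]
      connecting_rank_le_rel[of "i + 1"] assms[of i] assms[of "i + 1"] by linarith
qed

text \<open>In every degree the source or the target of the connecting homomorphism vanishes, so its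
  rank is zero.\<close>

lemma betti_eq_add:
  assumes "\<And>i. betti L (i - 1) = 0 \<or> betti (K - L) i = 0"
  shows "betti K i = betti L i + betti (K - L) i"
proof -
  have "connecting_rank i = 0" for i
    using assms[of i] connecting_rank_nonneg[of i] connecting_rank_le_rel[of i] connecting_rank_le_sub[of i]
    by linarith
  then show ?thesis using betti_eq[of i] by simp
qed

end

lemma is_complex_empty: "is_complex {}"
  by (simp add: is_complex_def)

text \<open>The subcomplex of the pair is the empty family, which lacks even the empty face, so the
  relative faces are all faces of \<open>K\<close>.\<close>

lemma betti_toggle:
  assumes "is_complex K" and "\<And>\<sigma>. v \<notin> \<sigma> \<Longrightarrow> \<sigma> \<in> K \<longleftrightarrow> insert v \<sigma> \<in> K"
  shows "betti K i = 0"
proof -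
  interpret complex_pair K "{}"
    using assms(1) by (simp add: complex_pair_def is_complex_empty)
  show ?thesis using betti_rel_toggle[of v i] assms(2) by simp
qed

text \<open>Pulling chains back along \<open>f\<close> commutes with the boundary because incidence
  depends on inclusion and cardinality only. The shift \<open>m\<close> is \<open>0\<close> for a
  relabelling, \<open>1\<close> when a vertex is added to the faces of its link, and
  \<open>card V\<close> when all vertices of an edge \<open>V\<close> are added.\<close>

lemma betti_bij:
  assumes finM: "finite M" and bij: "bij_betw f M N"
    and card: "\<And>\<sigma>. \<sigma> \<in> M \<Longrightarrow> card (f \<sigma>) = card \<sigma> + m"
    and covers: "\<And>\<sigma> \<tau>. \<sigma> \<in> M \<Longrightarrow> \<tau> \<in> M \<Longrightarrow> f \<tau> \<subseteq> f \<sigma> \<longleftrightarrow> \<tau> \<subseteq> \<sigma>"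
  shows "betti N (i + int m) = betti M i"
proof -
  let ?g = "the_inv_into M f"
  have inj: "inj_on f M" and img: "f ` M = N" using bij by (auto simp: bij_betw_def)
  have finN: "finite N" using finM img by blast
  have g: "?g \<sigma> \<in> M" "f (?g \<sigma>) = \<sigma>" if "\<sigma> \<in> N" for \<sigma>
    using that inj img the_inv_into_into[OF inj] f_the_inv_into_f[OF inj] by auto
  have gf: "?g (f \<sigma>) = \<sigma>" if "\<sigma> \<in> M" for \<sigma>
    using that inj by (rule the_inv_into_f_f[rotated])
  define pull where "pull = (\<lambda>(c :: 'b set \<Rightarrow> bit) \<sigma>. if \<sigma> \<in> M then c (f \<sigma>) else 0)"
  have faces: "f \<sigma> \<in> faces N (j + int m) \<longleftrightarrow> \<sigma> \<in> faces M j" if "\<sigma> \<in> M" for \<sigma> j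
    using that card img by (auto simp: faces_def)
  have card_faces: "card (faces N (j + int m)) = card (faces M j)" for j
  proof -
    have "f ` faces M j = faces N (j + int m)"
      using faces img by (auto simp: faces_def image_iff)
    moreover have "inj_on f (faces M j)" using inj by (rule inj_on_subset) (auto simp: faces_def)
    ultimately show ?thesis by (metis card_image)
  qed
  have cov: "covers (f \<tau>) (f \<sigma>) \<longleftrightarrow> covers \<tau> \<sigma>" if "\<sigma> \<in> M" "\<tau> \<in> M" for \<sigma> \<tau>
    using that covers card by (simp add: covers_def)
  have pull_boundary: "pull (rel_boundary N c) = rel_boundary M (pull c)" for c
  proof
    fix \<tau>
    show "pull (rel_boundary N c) \<tau> = rel_boundary M (pull c) \<tau>"
    proof (cases "\<tau> \<in> M")
      case True
      then have "f \<tau> \<in> N" using img by blast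
      then have "pull (rel_boundary N c) \<tau> = (\<Sum>\<sigma>\<in>N. if covers (f \<tau>) \<sigma> then c \<sigma> else 0)"
        using True by (simp add: pull_def rel_boundary_def)
      also have "\<dots> = (\<Sum>\<sigma>\<in>M. if covers (f \<tau>) (f \<sigma>) then c (f \<sigma>) else 0)"
        by (rule sum.reindex_bij_betw[OF bij, symmetric])
      also have "\<dots> = (\<Sum>\<sigma>\<in>M. if covers \<tau> \<sigma> then pull c \<sigma> else 0)"
        by (intro sum.cong refl if_cong) (simp_all add: cov True pull_def)
      finally show ?thesis using True by (simp add: rel_boundary_def)
    qed (simp add: pull_def rel_boundary_outside)
  qed
  \<comment> \<open>\<open>pull\<close> forgets values off \<open>N\<close>, so injectivity is
    claimed for functions supported on \<open>N\<close>; boundaries are of this kind.\<close>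
  have pull_inj: "inj_on pull {c. \<forall>\<sigma>. \<sigma> \<notin> N \<longrightarrow> c \<sigma> = 0}"
  proof (rule inj_onI, rule ext)
    fix c d \<sigma>
    assume cd: "c \<in> {c. \<forall>\<sigma>. \<sigma> \<notin> N \<longrightarrow> c \<sigma> = 0}" "d \<in> {c. \<forall>\<sigma>. \<sigma> \<notin> N \<longrightarrow> c \<sigma> = 0}" "pull c = pull d"
    show "c \<sigma> = d \<sigma>"
    proof (cases "\<sigma> \<in> N")
      case True
      then show ?thesis using fun_cong[OF cd(3), of "?g \<sigma>"] g[OF True] by (simp add: pull_def)
    next
      case False
      then show ?thesis using cd by simp
    qed
  qed
  have pull_chains: "pull ` chains N (j + int m) = chains M j" for j
  proof (intro equalityI subsetI)
    fix c assume "c \<in> pull ` chains N (j + int m)"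
    then obtain d where d: "d \<in> chains N (j + int m)" "c = pull d" by blast
    have "\<sigma> \<in> faces M j" if "c \<sigma> \<noteq> 0" for \<sigma>
    proof -
      have "\<sigma> \<in> M" "d (f \<sigma>) \<noteq> 0" using that d(2) by (auto simp: pull_def split: if_splits)
      then show ?thesis using d(1) faces unfolding chains_def by blast
    qed
    then show "c \<in> chains M j" unfolding chains_def by blast
  next
    fix c assume c: "c \<in> chains M j"
    define d where "d = (\<lambda>\<sigma>. if \<sigma> \<in> N then c (?g \<sigma>) else 0)"
    have "\<sigma> \<in> faces N (j + int m)" if "d \<sigma> \<noteq> 0" for \<sigma>
    proof -
      have s: "\<sigma> \<in> N" "c (?g \<sigma>) \<noteq> 0" using that by (auto simp: d_def split: if_splits)
      then have "?g \<sigma> \<in> faces M j" using c unfolding chains_def by blast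
      then show ?thesis using faces[OF g(1)[OF s(1)], of j] g(2)[OF s(1)] by simp
    qed
    then have "d \<in> chains N (j + int m)" unfolding chains_def by blast
    moreover have "c = pull d"
    proof
      fix \<sigma>
      show "c \<sigma> = pull d \<sigma>"
      proof (cases "\<sigma> \<in> M")
        case True
        then have "f \<sigma> \<in> N" using img by blast
        then show ?thesis using True by (simp add: pull_def d_def gf)
      next
        case False
        then show ?thesis using chains_outside[OF c False] by (simp add: pull_def)
      qed
    qed
    ultimately show "c \<in> pull ` chains N (j + int m)" by blast
  qed
  have rank: "rank_boundary N (j + int m) = rank_boundary M j" for j
  proof -
    have "pull ` rel_boundary N ` chains N (j + int m) = rel_boundary M ` chains M j"
      unfolding pull_chains[symmetric] image_image pull_boundary ..
    moreover have "inj_on pull (rel_boundary N ` chains N (j + int m))"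
      using pull_inj by (rule inj_on_subset) (auto simp: rel_boundary_outside)
    ultimately have "card (rel_boundary N ` chains N (j + int m)) = card (rel_boundary M ` chains M j)"
      by (metis card_image)
    then show ?thesis by (simp add: rank_boundary_def)
  qed
  have "rank_boundary N (i + int m + 1) = rank_boundary M (i + 1)"
    using rank[of "i + 1"] by (simp add: algebra_simps)
  then show ?thesis by (simp add: betti_def card_faces rank)
qed

section \<open>Independence complexes\<close>

lemma mem_indep_complex: "W \<in> indep_complex (V, E) \<longleftrightarrow> W \<subseteq> V \<and> (\<forall>e\<in>E. \<not> e \<subseteq> W)"
  by (auto simp: indep_complex_def independent_def)

lemma finite_indep_complex: "finite V \<Longrightarrow> finite (indep_complex (V, E))"
  by (rule finite_subset[of _ "Pow V"]) (auto simp: mem_indep_complex)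

lemma is_complex_indep:
  assumes "finite V"
  shows "is_complex (indep_complex (V, E))"
  unfolding is_complex_def
proof (intro conjI ballI allI impI)
  fix \<sigma> \<tau> assume s: "\<sigma> \<in> indep_complex (V, E)"
  then show "finite \<sigma>" using assms finite_subset[of \<sigma> V] by (simp add: mem_indep_complex)
  show "\<tau> \<in> indep_complex (V, E)" if "\<tau> \<subseteq> \<sigma>"
    using s that unfolding mem_indep_complex by blast
qed (rule finite_indep_complex[OF assms])

text \<open>Independence depends only on the upward closure of the edges, and the two conditions
  make the upward closures of \<open>E\<close> and \<open>F\<close> agree.\<close>

lemma indep_complex_cong:
  assumes "\<And>e. e \<in> E \<Longrightarrow> \<exists>f\<in>F. f \<subseteq> e" and "\<And>f. f \<in> F \<Longrightarrow> \<exists>e\<in>E. e \<subseteq> f"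
  shows "indep_complex (V, E) = indep_complex (V, F)"
proof (rule Set.set_eqI)
  fix W
  show "W \<in> indep_complex (V, E) \<longleftrightarrow> W \<in> indep_complex (V, F)"
    unfolding mem_indep_complex using assms by (meson subset_trans)
qed

text \<open>
  The faces of \<open>I(V, E)\<close> that contain \<open>e\<close> are paired off by toggling \<open>v\<close>.
\<close>

lemma betti_insert_edge:
  assumes V: "finite V" and v: "v \<in> V" "v \<notin> e"
    and dom: "\<And>f. f \<in> E \<Longrightarrow> v \<in> f \<Longrightarrow> \<exists>g\<in>E. g \<subseteq> f \<union> e \<and> v \<notin> g"
  shows "betti (indep_complex (V, insert e E)) i = betti (indep_complex (V, E)) i"
proof -
  let ?K = "indep_complex (V, E)" and ?L = "indep_complex (V, insert e E)"
  interpret complex_pair ?K ?L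
    using V by unfold_locales (auto simp: is_complex_indep mem_indep_complex)
  have KL: "\<sigma> \<in> ?K - ?L \<longleftrightarrow> \<sigma> \<subseteq> V \<and> (\<forall>f\<in>E. \<not> f \<subseteq> \<sigma>) \<and> e \<subseteq> \<sigma>" for \<sigma>
    by (auto simp: mem_indep_complex)
  have "\<sigma> \<in> ?K - ?L \<longleftrightarrow> insert v \<sigma> \<in> ?K - ?L" if "v \<notin> \<sigma>" for \<sigma>
  proof
    assume s: "\<sigma> \<in> ?K - ?L"
    \<comment> \<open>As \<open>e \<subseteq> \<sigma>\<close>, an edge \<open>f\<close> through
      \<open>v\<close> inside \<open>insert v \<sigma>\<close> would force the edge
      \<open>g\<close>, which avoids \<open>v\<close>, into \<open>\<sigma>\<close>.\<close>
    have "\<not> f \<subseteq> insert v \<sigma>" if f: "f \<in> E" for f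
    proof
      assume sub: "f \<subseteq> insert v \<sigma>"
      then have "v \<in> f" using s f unfolding KL by blast
      then obtain g where "g \<in> E" "g \<subseteq> f \<union> e" "v \<notin> g" using dom f by blast
      then show False using s sub unfolding KL by blast
    qed
    then show "insert v \<sigma> \<in> ?K - ?L" using s v unfolding KL by blast
  next
    assume "insert v \<sigma> \<in> ?K - ?L"
    then show "\<sigma> \<in> ?K - ?L" using v that unfolding KL by blast
  qed
  then have "betti (?K - ?L) i = 0" for i by (rule betti_rel_toggle)
  then show ?thesis using betti_eq_sub by simp
qed

text \<open>The edges of \<open>F\<close> are added one at a time. The edges present at any stage
  lie between \<open>E\<close> and \<open>E \<union> F\<close>, so asking for a \<open>g\<close> in
  \<open>E\<close> for all \<open>f\<close> in \<open>E \<union> F\<close> makes the order of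
  insertion irrelevant.\<close>

lemma betti_Un_edges:
  assumes "finite F" and "finite V"
    and dom: "\<And>e. e \<in> F \<Longrightarrow> \<exists>v\<in>V - e. \<forall>f\<in>E \<union> F. v \<in> f \<longrightarrow> (\<exists>g\<in>E. g \<subseteq> f \<union> e \<and> v \<notin> g)"
  shows "betti (indep_complex (V, E \<union> F)) i = betti (indep_complex (V, E)) i"
proof -
  have "betti (indep_complex (V, E \<union> G)) i = betti (indep_complex (V, E)) i" if "finite G" "G \<subseteq> F" for G
    using that
  proof (induction G rule: finite_induct)
    case (insert e G)
    then have "e \<in> F" by blast
    from dom[OF this] obtain v where v: "v \<in> V" "v \<notin> e"
        "\<forall>f\<in>E \<union> F. v \<in> f \<longrightarrow> (\<exists>g\<in>E. g \<subseteq> f \<union> e \<and> v \<notin> g)" by blast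
    have "betti (indep_complex (V, insert e (E \<union> G))) i = betti (indep_complex (V, E \<union> G)) i"
    proof (rule betti_insert_edge[OF assms(2) v(1,2)])
      fix f assume "f \<in> E \<union> G" "v \<in> f"
      then have "f \<in> E \<union> F" using insert.prems by blast
      then show "\<exists>g\<in>E \<union> G. g \<subseteq> f \<union> e \<and> v \<notin> g" using v(3) \<open>v \<in> f\<close> by blast
    qed
    then show ?case using insert by simp
  qed simp
  then show ?thesis using assms(1) by blast
qed

section \<open>Cones, joins with simplex boundaries, relabelling\<close>

lemma betti_cone:
  assumes "finite V" "v \<in> V" "\<And>e. e \<in> E \<Longrightarrow> v \<notin> e"
  shows "betti (indep_complex (V, E)) i = 0"
proof (rule betti_toggle)
  show "is_complex (indep_complex (V, E))" using assms by (simp add: is_complex_indep)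
  show "\<sigma> \<in> indep_complex (V, E) \<longleftrightarrow> insert v \<sigma> \<in> indep_complex (V, E)" if "v \<notin> \<sigma>" for \<sigma>
    using assms(2,3) unfolding mem_indep_complex by blast
qed

text \<open>Without the edge \<open>V\<close> the complex is a cone over any vertex of
  \<open>V\<close>, so with it the homology is that of the pair one degree up. The faces lost are
  \<open>V \<union> \<sigma>\<close> with \<open>\<sigma>\<close> a face on \<open>W\<close>, which
  lowers the degree by \<open>card V\<close> again.\<close>

lemma betti_simplex_boundary_join:
  assumes V: "finite V" "V \<noteq> {}" and W: "finite W" "V \<inter> W = {}" and E: "\<And>e. e \<in> E \<Longrightarrow> e \<subseteq> W"
  shows "betti (indep_complex (V \<union> W, insert V E)) i = betti (indep_complex (W, E)) (i + 1 - int (card V))"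
proof -
  let ?K = "indep_complex (V \<union> W, E)" and ?L = "indep_complex (V \<union> W, insert V E)"
  interpret complex_pair ?K ?L
    using V W by unfold_locales (auto simp: is_complex_indep mem_indep_complex)
  obtain v where "v \<in> V" using V by blast
  then have "betti ?K i = 0" for i
    using V W E by (intro betti_cone[of _ v]) blast+
  then have "betti ?L i = betti (?K - ?L) (i + 1)" by (rule betti_sub_eq_rel)
  also have "\<dots> = betti (?K - ?L) ((i + 1 - int (card V)) + int (card V))" by simp
  also have "\<dots> = betti (indep_complex (W, E)) (i + 1 - int (card V))"
  proof (rule betti_bij[where f = "\<lambda>\<sigma>. V \<union> \<sigma>"])
    show "finite (indep_complex (W, E))" by (rule finite_indep_complex[OF W(1)])
    show "bij_betw ((\<union>) V) (indep_complex (W, E)) (?K - ?L)"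
    proof (rule bij_betwI[where g = "\<lambda>\<sigma>. \<sigma> - V"])
      show "(\<union>) V \<in> indep_complex (W, E) \<rightarrow> ?K - ?L"
        using W E unfolding Pi_def mem_indep_complex Diff_iff by blast
      show "(\<lambda>\<sigma>. \<sigma> - V) \<in> ?K - ?L \<rightarrow> indep_complex (W, E)"
        using W unfolding Pi_def mem_indep_complex Diff_iff by blast
    qed (use W in \<open>auto simp: mem_indep_complex\<close>)
    show "card (V \<union> \<sigma>) = card \<sigma> + card V" if "\<sigma> \<in> indep_complex (W, E)" for \<sigma>
    proof -
      have "\<sigma> \<subseteq> W" using that by (simp add: mem_indep_complex)
      then show ?thesis using V W finite_subset[of \<sigma> W] by (subst card_Un_disjoint) auto
    qed
    show "V \<union> \<tau> \<subseteq> V \<union> \<sigma> \<longleftrightarrow> \<tau> \<subseteq> \<sigma>" if "\<sigma> \<in> indep_complex (W, E)" "\<tau> \<in> indep_complex (W, E)" for \<sigma> \<tau>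
      using that W unfolding mem_indep_complex by blast
  qed
  finally show ?thesis .
qed

lemma inj_on_image_subset_iff:
  assumes "inj_on f V" "A \<subseteq> V" "B \<subseteq> V"
  shows "f ` A \<subseteq> f ` B \<longleftrightarrow> A \<subseteq> B"
proof
  assume "f ` A \<subseteq> f ` B"
  then show "A \<subseteq> B" using inj_on_image_mem_iff[OF assms(1)] assms(2,3) by blast
qed (rule image_mono)

lemma betti_relabel:
  assumes V: "finite V" and inj: "inj_on f V" and E: "\<And>e. e \<in> E \<Longrightarrow> e \<subseteq> V"
  shows "betti (indep_complex (f ` V, (`) f ` E)) i = betti (indep_complex (V, E)) i"
proof -
  have "betti (indep_complex (f ` V, (`) f ` E)) (i + int 0) = betti (indep_complex (V, E)) i"
  proof (rule betti_bij[where f = "image f"])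
    show "finite (indep_complex (V, E))" by (rule finite_indep_complex[OF V])
    show "bij_betw (image f) (indep_complex (V, E)) (indep_complex (f ` V, (`) f ` E))"
      unfolding bij_betw_def
    proof
      show "inj_on (image f) (indep_complex (V, E))"
        using inj by (auto simp: inj_on_def mem_indep_complex inj_on_image_eq_iff[OF inj])
      show "image f ` indep_complex (V, E) = indep_complex (f ` V, (`) f ` E)"
      proof (intro equalityI subsetI)
        fix \<sigma> assume "\<sigma> \<in> indep_complex (f ` V, (`) f ` E)"
        then have s: "\<sigma> \<subseteq> f ` V" "\<And>e. e \<in> E \<Longrightarrow> \<not> f ` e \<subseteq> \<sigma>" by (auto simp: mem_indep_complex)
        then obtain \<tau> where "\<tau> \<subseteq> V" "\<sigma> = f ` \<tau>" by (meson subset_imageE)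
        then show "\<sigma> \<in> image f ` indep_complex (V, E)"
          using s(2) by (intro image_eqI[of _ _ \<tau>]) (auto simp: mem_indep_complex)
      next
        fix \<sigma> assume "\<sigma> \<in> image f ` indep_complex (V, E)"
        then obtain \<tau> where t: "\<sigma> = f ` \<tau>" "\<tau> \<subseteq> V" "\<And>e. e \<in> E \<Longrightarrow> \<not> e \<subseteq> \<tau>"
          by (auto simp: mem_indep_complex)
        then show "\<sigma> \<in> indep_complex (f ` V, (`) f ` E)"
          using inj_on_image_subset_iff[OF inj E] by (auto simp: mem_indep_complex)
      qed
    qed
    show "card (f ` \<sigma>) = card \<sigma> + 0" if "\<sigma> \<in> indep_complex (V, E)" for \<sigma>
      using that inj_on_subset[OF inj] by (simp add: mem_indep_complex card_image)
    show "f ` \<tau> \<subseteq> f ` \<sigma> \<longleftrightarrow> \<tau> \<subseteq> \<sigma>" if "\<sigma> \<in> indep_complex (V, E)" "\<tau> \<in> indep_complex (V, E)" for \<sigma> \<tau>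
      using that by (intro inj_on_image_subset_iff[OF inj]) (simp_all add: mem_indep_complex)
  qed
  then show ?thesis by simp
qed

section \<open>Deletion and link of a vertex\<close>

locale vertex =
  fixes V :: "'a set" and E :: "'a set set" and v :: 'a
  assumes V: "finite V" and v: "v \<in> V"
begin

abbreviation deletion where "deletion \<equiv> indep_complex (V - {v}, {e \<in> E. v \<notin> e})"
abbreviation link where "link \<equiv> indep_complex (V - {v}, (\<lambda>e. e - {v}) ` E)"

sublocale complex_pair "indep_complex (V, E)" deletion
proof
  show "deletion \<subseteq> indep_complex (V, E)"
  proof
    fix \<sigma> assume "\<sigma> \<in> deletion"
    then show "\<sigma> \<in> indep_complex (V, E)" unfolding mem_indep_complex by blast
  qed
qed (use V in \<open>simp_all add: is_complex_indep\<close>)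

lemma betti_rel_eq_link: "betti (indep_complex (V, E) - deletion) i = betti link (i - 1)"
proof -
  have "betti (indep_complex (V, E) - deletion) (i - 1 + int 1) = betti link (i - 1)"
  proof (rule betti_bij[where f = "insert v"])
    show "finite link" using V by (intro finite_indep_complex) simp
    have KL: "\<sigma> \<in> indep_complex (V, E) - deletion \<longleftrightarrow> \<sigma> \<subseteq> V \<and> v \<in> \<sigma> \<and> (\<forall>e\<in>E. \<not> e \<subseteq> \<sigma>)" for \<sigma>
      unfolding mem_indep_complex Diff_iff by blast
    show "bij_betw (insert v) link (indep_complex (V, E) - deletion)"
    proof (rule bij_betwI[where g = "\<lambda>\<sigma>. \<sigma> - {v}"])
      show "insert v \<in> link \<rightarrow> indep_complex (V, E) - deletion"
        using v unfolding Pi_def KL mem_indep_complex by blast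
      show "(\<lambda>\<sigma>. \<sigma> - {v}) \<in> indep_complex (V, E) - deletion \<rightarrow> link"
        unfolding Pi_def KL mem_indep_complex by blast
      show "insert v \<sigma> - {v} = \<sigma>" if "\<sigma> \<in> link" for \<sigma>
        using that unfolding mem_indep_complex by blast
      show "insert v (\<sigma> - {v}) = \<sigma>" if "\<sigma> \<in> indep_complex (V, E) - deletion" for \<sigma>
        using that unfolding KL by blast
    qed
    show "card (insert v \<sigma>) = card \<sigma> + 1" if "\<sigma> \<in> link" for \<sigma>
    proof -
      have "\<sigma> \<subseteq> V - {v}" using that by (simp add: mem_indep_complex)
      then have "finite \<sigma>" "v \<notin> \<sigma>" using V finite_subset[of \<sigma> V] by auto
      then show ?thesis by simp
    qed
    show "insert v \<tau> \<subseteq> insert v \<sigma> \<longleftrightarrow> \<tau> \<subseteq> \<sigma>" if "\<sigma> \<in> link" "\<tau> \<in> link" for \<sigma> \<tau>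
    proof -
      have "v \<notin> \<tau>" using that by (auto simp: mem_indep_complex)
      then show ?thesis by blast
    qed
  qed
  then show ?thesis by simp
qed

end

text \<open>The sphere of dimension \<open>-1\<close>, to which all nonzero Betti numbers below are
  traced back.\<close>

lemma betti_indep_empty: "betti (indep_complex ({} :: 'a set, {})) i = (if i = -1 then 1 else 0)"
proof -
  let ?K = "{{}} :: 'a set set"
  have eq: "indep_complex ({}, {}) = ?K" by (auto simp: mem_indep_complex)
  have "rel_boundary ?K c = 0" for c
    by (auto simp: rel_boundary_def covers_def fun_eq_iff)
  then have "rel_boundary ?K ` chains ?K j = {0}" for j
    using zero_chains[of ?K j] by (auto simp: image_iff simp del: zero_chains)
  then have "rank_boundary ?K j = 0" for j by (simp add: rank_boundary_def)
  moreover have "faces ?K i = (if i = -1 then {{}} else {})" by (auto simp: faces_def)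
  ultimately show ?thesis by (simp add: eq betti_def)
qed

section \<open>Tight paths and tight cycles\<close>

definition line_edges :: "nat \<Rightarrow> nat \<Rightarrow> nat set set" where
  "line_edges n k = {{s..<s + k} |s. s + k \<le> n}"

text \<open>The cyclic window of length \<open>k\<close> with \<open>a\<close> vertices before the
  seam between \<open>n - 1\<close> and \<open>0\<close> and \<open>k - a\<close> vertices after it.
  For \<open>a = 0\<close> it degenerates to \<open>{0..<k}\<close>, a value that occurs in
  links.\<close>

definition wrap_edge :: "nat \<Rightarrow> nat \<Rightarrow> nat \<Rightarrow> nat set" where
  "wrap_edge n k a = {0..<k - a} \<union> {n - a..<n}"

definition cyclic_edges :: "nat \<Rightarrow> nat \<Rightarrow> nat set set" where
  "cyclic_edges n k = line_edges n k \<union> wrap_edge n k ` {1..<k}"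

abbreviation path_complex :: "nat \<Rightarrow> nat \<Rightarrow> nat set set" where
  "path_complex n k \<equiv> indep_complex ({0..<n}, line_edges n k)"

abbreviation cycle_complex :: "nat \<Rightarrow> nat \<Rightarrow> nat set set" where
  "cycle_complex n k \<equiv> indep_complex ({0..<n}, cyclic_edges n k)"

lemma line_edgesI: "s + k \<le> n \<Longrightarrow> {s..<s + k} \<in> line_edges n k"
  by (auto simp: line_edges_def)

lemma line_edges_subset: "e \<in> line_edges n k \<Longrightarrow> e \<subseteq> {0..<n}"
  by (auto simp: line_edges_def)

section \<open>Identification with tight paths and tight cycles\<close>

lemma betti_tight_path: "betti (indep_complex (tight_path n k)) i = betti (path_complex n k) i"
proof -
  have "{{i + 1..i + k} |i. i + k \<le> n} = (`) Suc ` line_edges n k"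
  proof -
    have eq: "{i + 1..i + k} = Suc ` {i..<i + k}" for i by (simp add: image_Suc_atLeastLessThan atLeastLessThanSuc_atLeastAtMost)
    show ?thesis unfolding line_edges_def setcompr_eq_image image_image eq ..
  qed
  moreover have "{1..n} = Suc ` {0..<n}" by (simp add: image_Suc_atLeastLessThan atLeastLessThanSuc_atLeastAtMost)
  ultimately have "tight_path n k = (Suc ` {0..<n}, (`) Suc ` line_edges n k)"
    by (simp only: tight_path_def)
  then show ?thesis using betti_relabel[of "{0..<n}" Suc "line_edges n k"] line_edges_subset by simp
qed

lemma cyclic_window:
  assumes "i < n" "k \<le> n" "n < i + k"
  shows "{(i + j) mod n |j. j < k} = wrap_edge n k (n - i)"
proof (rule Set.set_eqI)
  fix x
  show "x \<in> {(i + j) mod n |j. j < k} \<longleftrightarrow> x \<in> wrap_edge n k (n - i)"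
  proof
    assume "x \<in> {(i + j) mod n |j. j < k}"
    then obtain j where j: "j < k" "x = (i + j) mod n" by blast
    show "x \<in> wrap_edge n k (n - i)"
    proof (cases "i + j < n")
      case True
      then show ?thesis using j assms by (auto simp: wrap_edge_def)
    next
      case False
      then have "x = i + j - n" using j assms by (simp add: mod_if)
      then show ?thesis using j False assms by (auto simp: wrap_edge_def)
    qed
  next
    assume "x \<in> wrap_edge n k (n - i)"
    then consider "x < k - (n - i)" | "i \<le> x" "x < n" using assms by (auto simp: wrap_edge_def)
    then show "x \<in> {(i + j) mod n |j. j < k}"
    proof cases
      case 1
      then have "(i + (x + n - i)) mod n = x" "x + n - i < k" using assms by auto
      then show ?thesis by (metis (mono_tags, lifting) mem_Collect_eq)
    next
      case 2
      then have "(i + (x - i)) mod n = x" "x - i < k" using assms by auto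
      then show ?thesis by (metis (mono_tags, lifting) mem_Collect_eq)
    qed
  qed
qed

lemma straight_window:
  fixes i k n :: nat
  assumes "i + k \<le> n"
  shows "{(i + j) mod n |j. j < k} = {i..<i + k}"
proof (rule Set.set_eqI)
  fix x
  show "x \<in> {(i + j) mod n |j. j < k} \<longleftrightarrow> x \<in> {i..<i + k}"
  proof
    assume "x \<in> {i..<i + k}"
    then have "(i + (x - i)) mod n = x" "x - i < k" using assms by auto
    then show "x \<in> {(i + j) mod n |j. j < k}" by (metis (mono_tags, lifting) mem_Collect_eq)
  qed (use assms in auto)
qed

lemma tight_cycle_eq:
  assumes "1 \<le> k" "k \<le> n"
  shows "tight_cycle n k = ({0..<n}, cyclic_edges n k)"
proof -
  have "{{(i + j) mod n |j. j < k} |i. i < n} = cyclic_edges n k"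
  proof (intro equalityI subsetI)
    fix e assume "e \<in> {{(i + j) mod n |j. j < k} |i. i < n}"
    then obtain i where i: "i < n" "e = {(i + j) mod n |j. j < k}" by blast
    show "e \<in> cyclic_edges n k"
    proof (cases "i + k \<le> n")
      case True
      then show ?thesis using i(2) straight_window[OF True] line_edgesI[OF True] by (simp add: cyclic_edges_def)
    next
      case False
      then have "n - i \<in> {1..<k}" using i by auto
      then show ?thesis using i False cyclic_window[of i n k] assms by (simp add: cyclic_edges_def)
    qed
  next
    fix e assume "e \<in> cyclic_edges n k"
    then consider s where "s + k \<le> n" "e = {s..<s + k}" | a where "1 \<le> a" "a < k" "e = wrap_edge n k a"
      by (auto simp: cyclic_edges_def line_edges_def)
    then show "e \<in> {{(i + j) mod n |j. j < k} |i. i < n}"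
    proof cases
      case 1
      then show ?thesis using straight_window[of s k n] assms by (intro CollectI exI[of _ s]) auto
    next
      case 2
      then show ?thesis using cyclic_window[of "n - a" n k] assms by (intro CollectI exI[of _ "n - a"]) auto
    qed
  qed
  then show ?thesis by (simp add: tight_cycle_def)
qed

section \<open>Cutting out the vertex \<open>k\<close>; paths\<close>

text \<open>The edge \<open>{k}\<close> forbids the vertex \<open>k\<close>, so the windows starting
  at \<open>1, ..., k\<close> impose no condition any more, and \<open>{0..<k}\<close> is separated
  from the windows beyond \<open>k\<close>.\<close>

lemma split_at_vertex:
  "indep_complex ({0..<n}, insert {k} (line_edges n k \<union> F))
    = indep_complex ({0..<k} \<union> {k + 1..<n}, insert {0..<k} ({{s..<s + k} |s. k < s \<and> s + k \<le> n} \<union> F))"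
  if "k < n"
proof (rule Set.set_eqI)
  fix W
  have lines: "(\<forall>e\<in>line_edges n k. \<not> e \<subseteq> W) \<longleftrightarrow>
      \<not> {0..<k} \<subseteq> W \<and> (\<forall>s. k < s \<and> s + k \<le> n \<longrightarrow> \<not> {s..<s + k} \<subseteq> W)" if "k \<notin> W"
  proof -
    have sub: "\<not> {s..<s + k} \<subseteq> W" if "0 < s" "s \<le> k" for s
    proof -
      have "k \<in> {s..<s + k}" using that by simp
      then show ?thesis using \<open>k \<notin> W\<close> by blast
    qed
    have "(\<forall>e\<in>line_edges n k. \<not> e \<subseteq> W) \<longleftrightarrow> (\<forall>s. s + k \<le> n \<longrightarrow> \<not> {s..<s + k} \<subseteq> W)"
      by (auto simp: line_edges_def)
    also have "\<dots> \<longleftrightarrow> \<not> {0..<k} \<subseteq> W \<and> (\<forall>s. k < s \<and> s + k \<le> n \<longrightarrow> \<not> {s..<s + k} \<subseteq> W)"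
    proof
      assume line: "\<forall>s. s + k \<le> n \<longrightarrow> \<not> {s..<s + k} \<subseteq> W"
      then show "\<not> {0..<k} \<subseteq> W \<and> (\<forall>s. k < s \<and> s + k \<le> n \<longrightarrow> \<not> {s..<s + k} \<subseteq> W)"
        using spec[OF line, of 0] \<open>k < n\<close> by simp
    next
      assume split: "\<not> {0..<k} \<subseteq> W \<and> (\<forall>s. k < s \<and> s + k \<le> n \<longrightarrow> \<not> {s..<s + k} \<subseteq> W)"
      show "\<forall>s. s + k \<le> n \<longrightarrow> \<not> {s..<s + k} \<subseteq> W"
      proof (intro allI impI)
        fix s assume "s + k \<le> n"
        then show "\<not> {s..<s + k} \<subseteq> W"
          using split sub[of s] by (cases "s = 0"; cases "s \<le> k") simp_all
      qed
    qed
    finally show ?thesis .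
  qed
  have V: "{0..<n} = insert k ({0..<k} \<union> {k + 1..<n})" using that by auto
  show "W \<in> indep_complex ({0..<n}, insert {k} (line_edges n k \<union> F)) \<longleftrightarrow>
      W \<in> indep_complex ({0..<k} \<union> {k + 1..<n}, insert {0..<k} ({{s..<s + k} |s. k < s \<and> s + k \<le> n} \<union> F))"
  proof (cases "k \<in> W")
    case True
    have "k \<notin> {0..<k} \<union> {k + 1..<n}" by simp
    then show ?thesis using True unfolding mem_indep_complex by blast
  next
    case False
    then have "W \<subseteq> {0..<n} \<longleftrightarrow> W \<subseteq> {0..<k} \<union> {k + 1..<n}" unfolding V by blast
    moreover have "(\<forall>e\<in>{{s..<s + k} |s. k < s \<and> s + k \<le> n}. \<not> e \<subseteq> W)
        \<longleftrightarrow> (\<forall>s. k < s \<and> s + k \<le> n \<longrightarrow> \<not> {s..<s + k} \<subseteq> W)" by blast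
    ultimately show ?thesis
      unfolding mem_indep_complex ball_simps ball_Un lines[OF False] using False by simp
  qed
qed

lemma shift_interval: "(+) c ` {a..<b} = {a + c..<b + c}" for a b c :: nat
  by (simp add: image_add_atLeastLessThan add.commute)

lemma shifted_line_edges:
  assumes "k < n"
  shows "{{s..<s + k} |s. k < s \<and> s + k \<le> n} = (`) ((+) (k + 1)) ` line_edges (n - k - 1) k"
proof (intro equalityI subsetI)
  fix e assume "e \<in> {{s..<s + k} |s. k < s \<and> s + k \<le> n}"
  then obtain s where s: "k < s" "s + k \<le> n" "e = {s..<s + k}" by blast
  then have "e = (+) (k + 1) ` {s - k - 1..<s - k - 1 + k}" unfolding shift_interval by simp
  then show "e \<in> (`) ((+) (k + 1)) ` line_edges (n - k - 1) k"
    using s by (intro image_eqI[of _ _ "{s - k - 1..<s - k - 1 + k}"] line_edgesI) auto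
next
  fix e assume "e \<in> (`) ((+) (k + 1)) ` line_edges (n - k - 1) k"
  then obtain s where s: "s + k \<le> n - k - 1" "e = (+) (k + 1) ` {s..<s + k}"
    by (auto simp: line_edges_def)
  then have "e = {s + k + 1..<s + k + 1 + k}" unfolding shift_interval by (simp add: algebra_simps)
  then show "e \<in> {{s..<s + k} |s. k < s \<and> s + k \<le> n}" using s assms
    by (intro CollectI exI[of _ "s + k + 1"]) auto
qed

text \<open>\<open>F\<close> holds the further edges of the shorter hypergraph in its own numbering:
  none for a path, the wrapped windows for a cycle.\<close>

lemma betti_split_at_vertex:
  assumes k: "1 \<le> k" "k < n" and E: "\<And>e. e \<in> F \<Longrightarrow> e \<subseteq> {0..<n - k - 1}"
  shows "betti (indep_complex ({0..<n}, insert {k} (line_edges n k \<union> (`) ((+) (k + 1)) ` F))) i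
    = betti (indep_complex ({0..<n - k - 1}, line_edges (n - k - 1) k \<union> F)) (i + 1 - int k)"
proof -
  let ?E = "line_edges (n - k - 1) k \<union> F" and ?f = "(+) (k + 1)"
  have W: "{k + 1..<n} = ?f ` {0..<n - k - 1}" unfolding shift_interval using k by simp
  have sub: "e \<subseteq> {0..<n - k - 1}" if "e \<in> ?E" for e using that E line_edges_subset by blast
  have "indep_complex ({0..<n}, insert {k} (line_edges n k \<union> (`) ?f ` F))
      = indep_complex ({0..<k} \<union> ?f ` {0..<n - k - 1}, insert {0..<k} ((`) ?f ` ?E))"
    unfolding split_at_vertex[OF k(2)] shifted_line_edges[OF k(2)] W image_Un ..
  moreover have "betti (indep_complex ({0..<k} \<union> ?f ` {0..<n - k - 1}, insert {0..<k} ((`) ?f ` ?E))) i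
      = betti (indep_complex (?f ` {0..<n - k - 1}, (`) ?f ` ?E)) (i + 1 - int (card {0..<k}))"
    by (rule betti_simplex_boundary_join) (use k sub in auto)
  moreover have "betti (indep_complex (?f ` {0..<n - k - 1}, (`) ?f ` ?E)) j
      = betti (indep_complex ({0..<n - k - 1}, ?E)) j" for j
    by (rule betti_relabel) (use sub in auto)
  ultimately show ?thesis by simp
qed

text \<open>The edge \<open>{k}\<close> is free to add, with \<open>0\<close> as toggled vertex:
  \<open>0\<close> lies on \<open>{0..<k}\<close> only, and the union of this edge with
  \<open>{k}\<close> contains the next window \<open>{1..<1 + k}\<close>.\<close>

lemma betti_path_step:
  assumes k: "1 \<le> k" "k < n"
  shows "betti (path_complex n k) i = betti (path_complex (n - k - 1) k) (i + 1 - int k)"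
proof -
  have "betti (indep_complex ({0..<n}, insert {k} (line_edges n k))) i = betti (path_complex n k) i"
  proof (rule betti_insert_edge[of _ 0])
    fix f assume "f \<in> line_edges n k" "0 \<in> f"
    then have "f = {0..<k}" by (auto simp: line_edges_def)
    moreover have "{1..<1 + k} \<in> line_edges n k" using k by (intro line_edgesI) simp
    ultimately show "\<exists>g\<in>line_edges n k. g \<subseteq> f \<union> {k} \<and> 0 \<notin> g"
      by (intro bexI[of _ "{1..<1 + k}"]) auto
  qed (use k in auto)
  then show ?thesis using betti_split_at_vertex[OF k, of "{}" i] by simp
qed

lemma betti_simplex_boundary:
  assumes "1 \<le> k"
  shows "betti (indep_complex ({0..<k}, {{0..<k}})) i = (if i = int k - 2 then 1 else 0)"
  using betti_simplex_boundary_join[of "{0..<k}" "{}" "{}" i] assms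
  by (auto simp: betti_indep_empty)

text \<open>The second family is indexed from \<open>n = 0\<close>, where the complex has the empty
  face only. This makes the recursion by \<open>k + 1\<close> uniform; its other bases are a full
  simplex for \<open>0 < n < k\<close> and a simplex boundary for \<open>n = k\<close>.\<close>

lemma betti_path:
  assumes k: "1 \<le> k"
  shows "betti (path_complex n k) i =
    (if (\<exists>q. i = int q * (int k - 1) + int k - 2 \<and> n = q * (k + 1) + k)
      \<or> (\<exists>q. i = int q * (int k - 1) - 1 \<and> n = q * (k + 1)) then 1 else 0)" (is "_ = (if ?P n i then 1 else 0)")
proof (induction n arbitrary: i rule: less_induct)
  case (less n)
  consider "n = 0" | "0 < n" "n < k" | "n = k" | "k < n" by linarith
  then show ?case
  proof cases
    case 1
    then have "line_edges n k = {}" using k by (auto simp: line_edges_def)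
    then show ?thesis using 1 k by (auto simp: betti_indep_empty)
  next
    case 2
    then have "line_edges n k = {}" using k by (auto simp: line_edges_def)
    moreover have "\<not> ?P n i"
    proof -
      have "n \<noteq> q * (k + 1) + k" "n \<noteq> q * (k + 1)" for q using 2 by (cases q; simp)+
      then show ?thesis by blast
    qed
    ultimately show ?thesis using 2 betti_cone[of "{0..<n}" 0 "{}" i] by simp
  next
    case 3
    then have "line_edges n k = {{0..<k}}" by (auto simp: line_edges_def)
    moreover have "?P n i \<longleftrightarrow> i = int k - 2"
    proof -
      have "k \<noteq> q * (k + 1)" for q using k by (cases q; simp)
      moreover have "k = q * (k + 1) + k \<longleftrightarrow> q = 0" for q by auto
      ultimately show ?thesis using 3 by auto
    qed
    ultimately show ?thesis using betti_simplex_boundary[OF k, of i] 3 by simp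
  next
    case 4
    let ?m = "n - k - 1"
    have n: "n = ?m + (k + 1)" using 4 by simp
    have "?P ?m (i + 1 - int k) \<longleftrightarrow> ?P n i"
    proof
      assume "?P ?m (i + 1 - int k)"
      then consider q where "i + 1 - int k = int q * (int k - 1) + int k - 2" "?m = q * (k + 1) + k"
        | q where "i + 1 - int k = int q * (int k - 1) - 1" "?m = q * (k + 1)" by blast
      then show "?P n i"
      proof cases
        case 1
        then have "i = int (Suc q) * (int k - 1) + int k - 2 \<and> n = Suc q * (k + 1) + k"
          using n by (simp add: algebra_simps)
        then show ?thesis by blast
      next
        case 2
        then have "i = int (Suc q) * (int k - 1) - 1 \<and> n = Suc q * (k + 1)"
          using n by (simp add: algebra_simps)
        then show ?thesis by blast
      qed
    next
      assume "?P n i"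
      then consider q where "i = int q * (int k - 1) + int k - 2" "n = q * (k + 1) + k"
        | q where "i = int q * (int k - 1) - 1" "n = q * (k + 1)" by blast
      then show "?P ?m (i + 1 - int k)"
      proof cases
        case 1
        then obtain p where "q = Suc p" using 4 by (cases q) auto
        then have "i + 1 - int k = int p * (int k - 1) + int k - 2 \<and> ?m = p * (k + 1) + k"
          using 1 by (simp add: algebra_simps)
        then show ?thesis by blast
      next
        case 2
        then obtain p where "q = Suc p" using 4 by (cases q) auto
        then have "i + 1 - int k = int p * (int k - 1) - 1 \<and> ?m = p * (k + 1)"
          using 2 by (simp add: algebra_simps)
        then show ?thesis by blast
      qed
    qed
    moreover have "betti (path_complex ?m k) (i + 1 - int k) = (if ?P ?m (i + 1 - int k) then 1 else 0)"
      using 4 by (intro less) simp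
    ultimately show ?thesis using betti_path_step[OF k 4] by simp
  qed
qed

section \<open>Cycles with at least \<open>2 * k + 1\<close> vertices\<close>

text \<open>The wrapped windows of the cycle that skips the block \<open>{0..k}\<close>: the last
  \<open>j\<close> vertices, followed by \<open>k - j\<close> vertices from \<open>k + 1\<close>
  on.\<close>

definition gap_edge :: "nat \<Rightarrow> nat \<Rightarrow> nat \<Rightarrow> nat set" where
  "gap_edge n k j = {k + 1..<2 * k + 1 - j} \<union> {n - j..<n}"

lemma shifted_wrap_edge:
  assumes "2 * k + 1 \<le> n" "j < k"
  shows "(+) (k + 1) ` wrap_edge (n - k - 1) k j = gap_edge n k j"
proof -
  have eqs: "0 + (k + 1) = k + 1" "k - j + (k + 1) = 2 * k + 1 - j" "n - k - 1 - j + (k + 1) = n - j"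
    "n - k - 1 + (k + 1) = n"
    using assms by auto
  show ?thesis unfolding wrap_edge_def gap_edge_def image_Un shift_interval eqs ..
qed

text \<open>
  Adding the gap edges, removing the edges through the gap between \<open>n - 1\<close> and \<open>0\<close>, and deleting
  the vertex \<open>k\<close> leaves the boundary of a simplex on \<open>{0..<k}\<close> joined with a shorter cycle. For
  \<open>n = 2 * k + 1\<close> that cycle has the single edge \<open>{0..<k}\<close>.
\<close>

lemma betti_cycle_step:
  assumes k: "1 \<le> k" and n: "2 * k + 1 \<le> n"
  shows "betti (cycle_complex n k) i = betti (cycle_complex (n - k - 1) k) (i + 1 - int k)"
proof -
  let ?V = "{0..<n}" and ?L = "line_edges n k" and ?W = "wrap_edge n k ` {1..<k}"
    and ?G = "gap_edge n k ` {1..<k}"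
  have add: "betti (indep_complex (?V, cyclic_edges n k \<union> ?G)) i = betti (cycle_complex n k) i"
  proof (rule betti_Un_edges)
    fix e assume "e \<in> ?G"
    then obtain j where j: "1 \<le> j" "j < k" "e = gap_edge n k j" by auto
    \<comment> \<open>The vertex \<open>k - j\<close> directly follows
      \<open>wrap_edge n k j\<close>. A window through it that starts at \<open>0\<close> or wraps
      around contains \<open>{0..<k - j}\<close>, and \<open>e\<close> supplies the last
      \<open>j\<close> vertices. Any other window through it starts between \<open>1\<close> and
      \<open>k - j\<close>, reaches \<open>k\<close>, and is continued by \<open>e\<close> to the
      end of the window starting at \<open>k - j + 1\<close>.\<close>
    have "\<exists>g\<in>cyclic_edges n k. g \<subseteq> f \<union> e \<and> k - j \<notin> g"
      if f: "f \<in> cyclic_edges n k \<union> ?G" "k - j \<in> f" for f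
    proof -
      have "k - j \<notin> gap_edge n k a" if "a < k" for a using n that j by (auto simp: gap_edge_def)
      then consider s where "s + k \<le> n" "f = {s..<s + k}" | a where "1 \<le> a" "a < k" "f = wrap_edge n k a"
        using f by (auto simp: cyclic_edges_def line_edges_def)
      then have "wrap_edge n k j \<subseteq> f \<union> e \<or> {k - j + 1..<k - j + 1 + k} \<subseteq> f \<union> e"
      proof cases
        case 1
        show ?thesis
        proof (cases "s = 0")
          case True
          then have "wrap_edge n k j \<subseteq> f \<union> e" using 1 j by (auto simp: wrap_edge_def gap_edge_def)
          then show ?thesis ..
        next
          case False
          then have "{k - j + 1..<k - j + 1 + k} \<subseteq> f \<union> e"
            using 1 j f(2) by (auto simp: gap_edge_def)
          then show ?thesis ..
        qed
      next
        case 2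
        then have "wrap_edge n k j \<subseteq> f \<union> e" using n j f(2) by (auto simp: wrap_edge_def gap_edge_def)
        then show ?thesis ..
      qed
      moreover have "wrap_edge n k j \<in> cyclic_edges n k" using j by (auto simp: cyclic_edges_def)
      moreover have "{k - j + 1..<k - j + 1 + k} \<in> cyclic_edges n k"
        using n j line_edgesI[of "k - j + 1" k n] by (auto simp: cyclic_edges_def)
      moreover have "k - j \<notin> wrap_edge n k j" using n j by (auto simp: wrap_edge_def)
      moreover have "k - j \<notin> {k - j + 1..<k - j + 1 + k}" by simp
      ultimately show ?thesis by blast
    qed
    moreover have "k - j \<in> ?V - e" using n j by (auto simp: gap_edge_def)
    ultimately show "\<exists>v\<in>?V - e. \<forall>f\<in>cyclic_edges n k \<union> ?G. v \<in> f \<longrightarrow>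
        (\<exists>g\<in>cyclic_edges n k. g \<subseteq> f \<union> e \<and> v \<notin> g)" by blast
  qed simp_all
  have remove: "betti (indep_complex (?V, (?L \<union> ?G) \<union> ?W)) i = betti (indep_complex (?V, ?L \<union> ?G)) i"
  proof (rule betti_Un_edges)
    fix e assume "e \<in> ?W"
    then obtain a where a: "1 \<le> a" "a < k" "e = wrap_edge n k a" by auto
    \<comment> \<open>The vertex \<open>k\<close> lies on straight windows only. One that starts at
      or before \<open>k - a\<close> completes the initial part of \<open>e\<close> to
      \<open>{0..<k}\<close>; a later one contains the \<open>k - a\<close> vertices after
      \<open>k\<close>, which form \<open>gap_edge n k a\<close> with the final part of
      \<open>e\<close>.\<close>
    have "\<exists>g\<in>?L \<union> ?G. g \<subseteq> f \<union> e \<and> k \<notin> g" if f: "f \<in> (?L \<union> ?G) \<union> ?W" "k \<in> f" for f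
    proof -
      have "k \<notin> gap_edge n k b" "k \<notin> wrap_edge n k b" if "b < k" for b
        using n that by (auto simp: gap_edge_def wrap_edge_def)
      then obtain s where s: "s + k \<le> n" "f = {s..<s + k}"
        using f by (auto simp: line_edges_def)
      have "{0..<k} \<subseteq> f \<union> e \<or> gap_edge n k a \<subseteq> f \<union> e"
      proof (cases "s \<le> k - a")
        case True
        then have "{0..<k} \<subseteq> f \<union> e" using s a f(2) by (auto simp: wrap_edge_def)
        then show ?thesis ..
      next
        case False
        then have "gap_edge n k a \<subseteq> f \<union> e" using s a f(2) by (auto simp: wrap_edge_def gap_edge_def)
        then show ?thesis ..
      qed
      moreover have "{0..<k} \<in> ?L" using line_edgesI[of 0 k n] n by simp
      moreover have "gap_edge n k a \<in> ?G" using a by auto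
      moreover have "k \<notin> gap_edge n k a" using n a by (auto simp: gap_edge_def)
      moreover have "k \<notin> {0..<k}" by simp
      ultimately show ?thesis by blast
    qed
    moreover have "k \<in> ?V - e" using n a by (auto simp: wrap_edge_def)
    ultimately show "\<exists>v\<in>?V - e. \<forall>f\<in>(?L \<union> ?G) \<union> ?W. v \<in> f \<longrightarrow> (\<exists>g\<in>?L \<union> ?G. g \<subseteq> f \<union> e \<and> v \<notin> g)" by blast
  qed simp_all
  \<comment> \<open>With the wrapped windows gone, \<open>0\<close> lies on \<open>{0..<k}\<close>
    only, as in a path.\<close>
  have delete: "betti (indep_complex (?V, insert {k} (?L \<union> ?G))) i = betti (indep_complex (?V, ?L \<union> ?G)) i"
  proof (rule betti_insert_edge[of _ 0])
    fix f assume f: "f \<in> ?L \<union> ?G" "0 \<in> f"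
    have "0 \<notin> gap_edge n k b" if "b < k" for b using n that by (auto simp: gap_edge_def)
    then have "f = {0..<k}" using f by (auto simp: line_edges_def)
    moreover have "{1..<1 + k} \<in> ?L" using n k by (intro line_edgesI) simp
    ultimately show "\<exists>g\<in>?L \<union> ?G. g \<subseteq> f \<union> {k} \<and> 0 \<notin> g"
      by (intro bexI[of _ "{1..<1 + k}"]) auto
  qed (use k n in auto)
  have "(`) ((+) (k + 1)) ` wrap_edge (n - k - 1) k ` {1..<k} = ?G"
    unfolding image_image by (rule image_cong[OF refl]) (use shifted_wrap_edge[OF n] in simp)
  moreover have "betti (indep_complex (?V, insert {k} (?L \<union> (`) ((+) (k + 1)) ` wrap_edge (n - k - 1) k ` {1..<k}))) i
      = betti (cycle_complex (n - k - 1) k) (i + 1 - int k)"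
    unfolding cyclic_edges_def
    by (rule betti_split_at_vertex) (use k n in \<open>auto simp: wrap_edge_def\<close>)
  moreover have "cyclic_edges n k \<union> ?G = (?L \<union> ?G) \<union> ?W" by (auto simp: cyclic_edges_def)
  ultimately show ?thesis using add remove delete by simp
qed

section \<open>Deletion and link of the last vertex of a cycle\<close>

lemma deletion_cycle:
  "{0..<Suc m} - {m} = {0..<m}"
  "{e \<in> cyclic_edges (Suc m) (Suc l). m \<notin> e} = line_edges m (Suc l)"
proof -
  show "{0..<Suc m} - {m} = {0..<m}" by auto
  show "{e \<in> cyclic_edges (Suc m) (Suc l). m \<notin> e} = line_edges m (Suc l)"
    by (auto simp: cyclic_edges_def line_edges_def wrap_edge_def)
qed

text \<open>Close up the remaining \<open>m\<close> vertices to a cycle. The windows through the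
  removed vertex shrink to the windows of length \<open>l\<close> that cross or touch the new seam;
  all others keep length \<open>l + 1\<close>.\<close>

lemma link_cycle:
  assumes "l < m"
  shows "(\<lambda>e. e - {m}) ` cyclic_edges (Suc m) (Suc l)
    = line_edges m (Suc l) \<union> insert {m - l..<m} (wrap_edge m l ` {0..<l})"
proof (intro equalityI subsetI)
  fix e assume "e \<in> (\<lambda>e. e - {m}) ` cyclic_edges (Suc m) (Suc l)"
  then consider s where "s + Suc l \<le> m" "e = {s..<s + Suc l} - {m}"
    | s where "s + Suc l = Suc m" "e = {s..<s + Suc l} - {m}"
    | a where "1 \<le> a" "a < Suc l" "e = wrap_edge (Suc m) (Suc l) a - {m}"
    unfolding cyclic_edges_def line_edges_def by (auto simp: le_Suc_eq)
  then show "e \<in> line_edges m (Suc l) \<union> insert {m - l..<m} (wrap_edge m l ` {0..<l})"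
  proof cases
    case 1
    then have "e = {s..<s + Suc l}" by auto
    then show ?thesis using line_edgesI[OF 1(1)] by simp
  next
    case 2
    then have "e = {m - l..<m}" by auto
    then show ?thesis by simp
  next
    case 3
    then have "e = wrap_edge m l (a - 1)" using assms by (auto simp: wrap_edge_def)
    then show ?thesis using 3 by simp
  qed
next
  fix e assume "e \<in> line_edges m (Suc l) \<union> insert {m - l..<m} (wrap_edge m l ` {0..<l})"
  then consider s where "s + Suc l \<le> m" "e = {s..<s + Suc l}"
    | "e = {m - l..<m}" | a where "a < l" "e = wrap_edge m l a"
    by (auto simp: line_edges_def)
  then show "e \<in> (\<lambda>e. e - {m}) ` cyclic_edges (Suc m) (Suc l)"
  proof cases
    case 1
    then show ?thesis using line_edgesI[of s "Suc l" "Suc m"]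
      by (intro image_eqI[of _ _ "{s..<s + Suc l}"]) (auto simp: cyclic_edges_def)
  next
    case 2
    then show ?thesis using line_edgesI[of "m - l" "Suc l" "Suc m"] assms
      by (intro image_eqI[of _ _ "{m - l..<m - l + Suc l}"]) (auto simp: cyclic_edges_def)
  next
    case 3
    then have "e = wrap_edge (Suc m) (Suc l) (Suc a) - {m}" using assms by (auto simp: wrap_edge_def)
    moreover have "wrap_edge (Suc m) (Suc l) (Suc a) \<in> cyclic_edges (Suc m) (Suc l)"
      using 3(1) by (simp add: cyclic_edges_def)
    ultimately show ?thesis by blast
  qed
qed

text \<open>The windows of length \<open>l\<close> absent from the link are those starting at
  \<open>1, ..., m - l - 1\<close>. Once they are added, every window of length \<open>l + 1\<close>
  contains a shorter one and becomes redundant.\<close>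

lemma link_cycle_complex:
  assumes l: "1 \<le> l" "l < m"
  shows "indep_complex ({0..<m}, (\<lambda>e. e - {m}) ` cyclic_edges (Suc m) (Suc l)
      \<union> (\<lambda>s. {s..<s + l}) ` {1..<m - l}) = cycle_complex m l"
proof (rule indep_complex_cong)
  fix e assume "e \<in> (\<lambda>e. e - {m}) ` cyclic_edges (Suc m) (Suc l) \<union> (\<lambda>s. {s..<s + l}) ` {1..<m - l}"
  then consider s where "s + Suc l \<le> m" "e = {s..<s + Suc l}"
    | "e = {m - l..<m}" | "e = wrap_edge m l 0" | a where "1 \<le> a" "a < l" "e = wrap_edge m l a"
    | s where "1 \<le> s" "s < m - l" "e = {s..<s + l}"
    unfolding link_cycle[OF l(2)] line_edges_def
    by (auto simp: Suc_le_eq) (metis not_gr_zero)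
  then show "\<exists>f\<in>cyclic_edges m l. f \<subseteq> e"
  proof cases
    case 1
    then show ?thesis using line_edgesI[of s l m]
      by (intro bexI[of _ "{s..<s + l}"]) (auto simp: cyclic_edges_def)
  next
    case 2
    then show ?thesis using line_edgesI[of "m - l" l m] l
      by (intro bexI[of _ "{m - l..<m - l + l}"]) (auto simp: cyclic_edges_def)
  next
    case 3
    then show ?thesis using line_edgesI[of 0 l m] l
      by (intro bexI[of _ "{0..<0 + l}"]) (auto simp: cyclic_edges_def wrap_edge_def)
  next
    case 4
    then show ?thesis by (intro bexI[of _ e]) (auto simp: cyclic_edges_def)
  next
    case 5
    then show ?thesis using line_edgesI[of s l m]
      by (intro bexI[of _ "{s..<s + l}"]) (auto simp: cyclic_edges_def)
  qed
next
  fix f assume "f \<in> cyclic_edges m l"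
  then consider s where "s + l \<le> m" "f = {s..<s + l}" | a where "1 \<le> a" "a < l" "f = wrap_edge m l a"
    by (auto simp: cyclic_edges_def line_edges_def)
  then have "f \<in> (\<lambda>e. e - {m}) ` cyclic_edges (Suc m) (Suc l) \<union> (\<lambda>s. {s..<s + l}) ` {1..<m - l}"
  proof cases
    case 1
    then consider "s = 0" | "1 \<le> s" "s < m - l" | "s = m - l" by linarith
    then show ?thesis
    proof cases
      case 1
      then have "f = wrap_edge m l 0" using \<open>f = {s..<s + l}\<close> by (simp add: wrap_edge_def)
      then show ?thesis using l unfolding link_cycle[OF l(2)] by simp
    next
      case 2
      then show ?thesis using \<open>f = {s..<s + l}\<close> by auto
    next
      case 3
      then have "f = {m - l..<m}" using \<open>f = {s..<s + l}\<close> l by simp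
      then show ?thesis unfolding link_cycle[OF l(2)] by simp
    qed
  next
    case 2
    then show ?thesis unfolding link_cycle[OF l(2)] by auto
  qed
  then show "\<exists>e\<in>(\<lambda>e. e - {m}) ` cyclic_edges (Suc m) (Suc l) \<union> (\<lambda>s. {s..<s + l}) ` {1..<m - l}. e \<subseteq> f"
    by blast
qed

lemma vertex_cycle: "vertex {0..<Suc m} m"
  by unfold_locales simp_all

lemma betti_rel_cycle:
  "betti (cycle_complex (Suc m) (Suc l) - path_complex m (Suc l)) i
    = betti (indep_complex ({0..<m}, (\<lambda>e. e - {m}) ` cyclic_edges (Suc m) (Suc l))) (i - 1)"
  using vertex.betti_rel_eq_link[OF vertex_cycle, of m "cyclic_edges (Suc m) (Suc l)" i]
  by (simp only: deletion_cycle)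

lemma complex_pair_cycle: "complex_pair (cycle_complex (Suc m) (Suc l)) (path_complex m (Suc l))"
proof -
  interpret vertex "{0..<Suc m}" "cyclic_edges (Suc m) (Suc l)" m by (rule vertex_cycle)
  show ?thesis using complex_pair_axioms by (simp only: deletion_cycle)
qed

text \<open>A missing window \<open>e\<close> lies in two edges of length \<open>l + 1\<close>,
  which extend it by one of its neighbours \<open>s - 1\<close> and \<open>s + l\<close>. Any edge
  through a vertex two steps away from \<open>e\<close> contains one of these neighbours: the edges
  are arcs with at least \<open>l\<close> vertices, and an arc avoiding both neighbours would have
  to fit into the other \<open>t - 1 < l\<close> vertices outside \<open>e\<close>.\<close>

lemma betti_link_cycle:
  assumes t: "2 \<le> t" "t \<le> l"
  shows "betti (indep_complex ({0..<l + 1 + t}, (\<lambda>e. e - {l + 1 + t}) ` cyclic_edges (Suc (l + 1 + t)) (Suc l))) i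
    = betti (cycle_complex (l + 1 + t) l) i"
proof -
  let ?m = "l + 1 + t"
  let ?E = "(\<lambda>e. e - {?m}) ` cyclic_edges (Suc ?m) (Suc l)" and ?F = "(\<lambda>s. {s..<s + l}) ` {1..<?m - l}"
  have lm: "l < ?m" "1 \<le> l" using t by auto
  have "betti (indep_complex ({0..<?m}, ?E \<union> ?F)) i = betti (indep_complex ({0..<?m}, ?E)) i"
  proof (rule betti_Un_edges)
    fix e assume "e \<in> ?F"
    then obtain s where s: "1 \<le> s" "s \<le> t" "e = {s..<s + l}" by auto
    \<comment> \<open>Two steps before \<open>e\<close>, or two steps after it if \<open>e\<close>
      starts at \<open>1\<close>; the vertex \<open>l + 2\<close> exists because
      \<open>t \<ge> 2\<close>.\<close>
    define v where "v = (if 2 \<le> s then s - 2 else l + 2)"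
    have g: "{s - 1..<s - 1 + Suc l} \<in> ?E" "{s..<s + Suc l} \<in> ?E"
      using s line_edgesI[of "s - 1" "Suc l" ?m] line_edgesI[of s "Suc l" ?m]
      unfolding link_cycle[OF lm(1)] by simp_all
    have vg: "v \<notin> {s - 1..<s - 1 + Suc l}" "v \<notin> {s..<s + Suc l}" using s by (auto simp: v_def)
    have dom: "\<exists>g\<in>?E. g \<subseteq> f \<union> e \<and> v \<notin> g" if f: "f \<in> ?E \<union> ?F" "v \<in> f" for f
    proof -
      have "s - 1 \<in> f \<or> s + l \<in> f"
      proof -
        consider r where "r + Suc l \<le> ?m" "f = {r..<r + Suc l}"
          | "f = {?m - l..<?m}" | a where "a < l" "f = wrap_edge ?m l a"
          | r where "1 \<le> r" "r \<le> t" "f = {r..<r + l}"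
          using f(1) unfolding link_cycle[OF lm(1)] line_edges_def by auto
        then show ?thesis
        proof cases
          case 1
          then show ?thesis using f(2) s t by (auto simp: v_def split: if_splits)
        next
          case 2
          then show ?thesis using f(2) s t by (auto simp: v_def split: if_splits)
        next
          case 3
          then show ?thesis using f(2) s t by (auto simp: v_def wrap_edge_def split: if_splits)
        next
          case 4
          then show ?thesis using f(2) s t by (auto simp: v_def split: if_splits)
        qed
      qed
      then have "{s - 1..<s - 1 + Suc l} \<subseteq> f \<union> e \<or> {s..<s + Suc l} \<subseteq> f \<union> e"
      proof
        assume a: "s - 1 \<in> f"
        have eq: "{s - 1..<s - 1 + Suc l} = insert (s - 1) e" using s by auto
        show ?thesis unfolding eq using a by blast
      next
        assume a: "s + l \<in> f"
        have eq: "{s..<s + Suc l} = insert (s + l) e" using s by auto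
        show ?thesis unfolding eq using a by blast
      qed
      then show ?thesis
      proof
        assume "{s - 1..<s - 1 + Suc l} \<subseteq> f \<union> e"
        then show ?thesis by (intro bexI[OF _ g(1)] conjI vg(1))
      next
        assume "{s..<s + Suc l} \<subseteq> f \<union> e"
        then show ?thesis by (intro bexI[OF _ g(2)] conjI vg(2))
      qed
    qed
    have v: "v \<in> {0..<?m} - e" using s t by (auto simp: v_def)
    show "\<exists>v\<in>{0..<?m} - e. \<forall>f\<in>?E \<union> ?F. v \<in> f \<longrightarrow> (\<exists>g\<in>?E. g \<subseteq> f \<union> e \<and> v \<notin> g)"
      by (intro bexI[OF _ v] ballI impI) (rule dom)
  qed simp_all
  then show ?thesis using link_cycle_complex[OF lm(2,1)] by simp
qed

text \<open>
  The set \<open>wrap_edge (l + 2) l a\<close> is the complement of \<open>{l - a, l - a + 1}\<close>.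
\<close>

lemma betti_pair_complements:
  "m \<le> l \<Longrightarrow> betti (indep_complex ({0..<l + 2}, wrap_edge (l + 2) l ` {..m})) i = 0"
proof (induction m)
  case 0
  \<comment> \<open>The only edge is \<open>{0..<l}\<close>, so \<open>l\<close> is an apex.\<close>
  have "betti (indep_complex ({0..<l + 2}, wrap_edge (l + 2) l ` {..0})) i = 0"
    by (rule betti_cone[of _ l]) (auto simp: wrap_edge_def)
  then show ?case .
next
  case (Suc m)
  have mem: "x \<in> wrap_edge (l + 2) l a \<longleftrightarrow> x < l + 2 \<and> x \<noteq> l - a \<and> x \<noteq> l - a + 1" if "a \<le> l" for x a
    using that by (auto simp: wrap_edge_def)
  have "betti (indep_complex ({0..<l + 2}, insert (wrap_edge (l + 2) l (Suc m)) (wrap_edge (l + 2) l ` {..m}))) i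
      = betti (indep_complex ({0..<l + 2}, wrap_edge (l + 2) l ` {..m})) i"
  \<comment> \<open>\<open>l - m\<close> is common to the complements of the edges with index
    \<open>m\<close> and \<open>m + 1\<close>. An old edge containing it has index below
    \<open>m\<close>; its complement is disjoint from that of the new edge, so their union is the
    whole vertex set.\<close>
  proof (rule betti_insert_edge[of _ "l - m"])
    have "l - m = l - Suc m + 1" using Suc.prems by linarith
    then show "l - m \<notin> wrap_edge (l + 2) l (Suc m)" using mem[OF Suc.prems, of "l - m"] by blast
    fix f assume f: "f \<in> wrap_edge (l + 2) l ` {..m}" "l - m \<in> f"
    then obtain a where a: "a \<le> m" "f = wrap_edge (l + 2) l a" by auto
    then have "a < m" using f(2) mem[of a "l - m"] Suc.prems by (cases "a = m") auto
    have "x \<in> f \<union> wrap_edge (l + 2) l (Suc m)" if "x \<in> wrap_edge (l + 2) l m" for x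
      using that \<open>a < m\<close> a(2) mem[of a x] mem[of "Suc m" x] mem[of m x] Suc.prems by auto
    moreover have "l - m \<notin> wrap_edge (l + 2) l m" using mem[of m "l - m"] Suc.prems by simp
    ultimately show "\<exists>g\<in>wrap_edge (l + 2) l ` {..m}. g \<subseteq> f \<union> wrap_edge (l + 2) l (Suc m) \<and> l - m \<notin> g"
      by (intro bexI[of _ "wrap_edge (l + 2) l m"]) auto
  qed auto
  then show ?case using Suc by (simp add: atMost_Suc)
qed

text \<open>The edges that matter are the complements of the pairs \<open>{j, j + 1}\<close> with
  \<open>j \<le> l\<close>. Among the adjacent pairs of a cycle on \<open>l + 2\<close> vertices
  just \<open>{l + 1, 0}\<close> is missing: the pairs form a path, so adding them from one end
  keeps the complex acyclic.\<close>

lemma betti_link_cycle_1: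
  assumes l: "1 \<le> l"
  shows "betti (indep_complex ({0..<l + 2}, (\<lambda>e. e - {l + 2}) ` cyclic_edges (Suc (l + 2)) (Suc l))) i = 0"
proof -
  have lm: "l < l + 2" by simp
  have w: "wrap_edge (l + 2) l 0 = {0..<l}" "wrap_edge (l + 2) l l = {2..<l + 2}"
    by (auto simp: wrap_edge_def)
  have "indep_complex ({0..<l + 2}, (\<lambda>e. e - {l + 2}) ` cyclic_edges (Suc (l + 2)) (Suc l))
      = indep_complex ({0..<l + 2}, wrap_edge (l + 2) l ` {..l})"
    unfolding link_cycle[OF lm]
  proof (rule indep_complex_cong)
    fix e assume "e \<in> line_edges (l + 2) (Suc l) \<union> insert {l + 2 - l..<l + 2} (wrap_edge (l + 2) l ` {0..<l})"
    then consider s where "s \<le> 1" "e = {s..<s + Suc l}" | "e = {2..<l + 2}" | a where "a < l" "e = wrap_edge (l + 2) l a"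
      by (auto simp: line_edges_def)
    then show "\<exists>f\<in>wrap_edge (l + 2) l ` {..l}. f \<subseteq> e"
    proof cases
      case 1
      then have "wrap_edge (l + 2) l 0 \<subseteq> e \<or> wrap_edge (l + 2) l l \<subseteq> e"
        unfolding w by (cases "s = 0") auto
      then show ?thesis by auto
    next
      case 2
      then show ?thesis using w(2) by auto
    next
      case 3
      then show ?thesis by auto
    qed
  next
    fix f assume "f \<in> wrap_edge (l + 2) l ` {..l}"
    then obtain a where a: "a \<le> l" "f = wrap_edge (l + 2) l a" by auto
    then have "f \<in> insert {l + 2 - l..<l + 2} (wrap_edge (l + 2) l ` {0..<l})"
      using w(2) by (cases "a = l") auto
    then show "\<exists>e\<in>line_edges (l + 2) (Suc l) \<union> insert {l + 2 - l..<l + 2} (wrap_edge (l + 2) l ` {0..<l}). e \<subseteq> f"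
      by blast
  qed
  then show ?thesis using betti_pair_complements[of l l i] by simp
qed

section \<open>Cycles with at most \<open>2 * k + 1\<close> vertices\<close>

text \<open>The edges are all \<open>k\<close>-subsets of \<open>k + 1\<close> vertices. Deleting a
  vertex leaves a simplex boundary with one class in degree \<open>k - 2\<close>; the link is the
  same complex for \<open>k - 1\<close> and adds \<open>k - 1\<close> classes in that degree. Both
  live in a single degree, so the connecting homomorphism is zero.\<close>

lemma betti_cycle_minimal:
  assumes "1 \<le> k"
  shows "betti (cycle_complex (k + 1) k) i = (if i = int k - 2 then real k else 0)"
  using assms
proof (induction k arbitrary: i rule: nat_induct_at_least)
  case base
  have "cyclic_edges (1 + 1) 1 = line_edges (1 + 1) 1" by (simp add: cyclic_edges_def)
  moreover have "1 + 1 \<noteq> q * (1 + 1) + (1 :: nat)" for q by presburger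
  moreover have "\<exists>q. 1 + 1 = q * (1 + 1 :: nat)" by (rule exI[of _ 1]) simp
  ultimately show ?case using betti_path[of 1 "1 + 1" i] by simp
next
  case (Suc l)
  interpret complex_pair "cycle_complex (Suc (l + 1)) (Suc l)" "path_complex (l + 1) (Suc l)"
    by (rule complex_pair_cycle)
  have "line_edges (l + 1) (Suc l) = {{0..<Suc l}}" by (auto simp: line_edges_def)
  then have L: "betti (path_complex (l + 1) (Suc l)) j = (if j = int (Suc l) - 2 then 1 else 0)" for j
    using betti_simplex_boundary[of "Suc l" j] by simp
  \<comment> \<open>With \<open>m = l + 1\<close> the link has all windows of length
    \<open>l\<close>, and nothing needs to be added.\<close>
  have "indep_complex ({0..<l + 1}, (\<lambda>e. e - {l + 1}) ` cyclic_edges (Suc (l + 1)) (Suc l)) = cycle_complex (l + 1) l"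
    using link_cycle_complex[of l "l + 1"] Suc.hyps by simp
  then have M: "betti (cycle_complex (Suc (l + 1)) (Suc l) - path_complex (l + 1) (Suc l)) j
      = (if j = int (Suc l) - 2 then real l else 0)" for j
    using betti_rel_cycle[of "l + 1" l j] Suc.IH[of "j - 1"] by auto
  have "betti (cycle_complex (Suc (l + 1)) (Suc l)) i
      = betti (path_complex (l + 1) (Suc l)) i
        + betti (cycle_complex (Suc (l + 1)) (Suc l) - path_complex (l + 1) (Suc l)) i"
  proof (rule betti_eq_add)
    fix j
    show "betti (path_complex (l + 1) (Suc l)) (j - 1) = 0
      \<or> betti (cycle_complex (Suc (l + 1)) (Suc l) - path_complex (l + 1) (Suc l)) j = 0"
      unfolding L M by simp
  qed
  then show ?case unfolding L M by simp
qed

text \<open>Removing a vertex and passing to its link lowers \<open>n\<close> and \<open>k\<close>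
  together, so \<open>t\<close> stays fixed. The descent ends at \<open>k = t\<close>, that is
  \<open>n = 2 * k + 1\<close>, the least length that \<open>betti_cycle_step\<close>
  covers.\<close>

lemma betti_cycle_short:
  assumes t: "1 \<le> t" "t \<le> k"
  shows "betti (cycle_complex (k + 1 + t) k) i = (if i = int k + int t - 3 then 1 else 0)"
  using t(2)
proof (induction k arbitrary: i rule: dec_induct)
  case base
  have "cyclic_edges t t = {{0..<t}}"
    using t by (auto simp: cyclic_edges_def line_edges_def wrap_edge_def)
  then have "betti (cycle_complex t t) (i + 1 - int t) = (if i + 1 - int t = int t - 2 then 1 else 0)"
    using betti_simplex_boundary[of t "i + 1 - int t"] t by simp
  then show ?case using betti_cycle_step[of t "t + 1 + t" i] t by auto
next
  case (step l)
  let ?m = "l + 1 + t"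
  interpret complex_pair "cycle_complex (Suc ?m) (Suc l)" "path_complex ?m (Suc l)"
    by (rule complex_pair_cycle)
  have m: "Suc l + 1 + t = Suc ?m" by simp
  show ?case
  proof (cases "t = 1")
    case True
    \<comment> \<open>The link is acyclic here, so the homology comes from the deletion, a path with
      one vertex more than its window length.\<close>
    then have "?m = l + 2" by simp
    then have "betti (cycle_complex (Suc ?m) (Suc l) - path_complex ?m (Suc l)) j = 0" for j
      using betti_rel_cycle[of ?m l j] betti_link_cycle_1[of l "j - 1"] step t by simp
    then have "betti (cycle_complex (Suc ?m) (Suc l)) i = betti (path_complex ?m (Suc l)) i"
      by (rule betti_eq_sub)
    also have "\<dots> = betti (path_complex 0 (Suc l)) (i + 1 - int (Suc l))"
      using betti_path_step[of "Suc l" ?m i] True by simp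
    also have "\<dots> = (if i = int (Suc l) + int t - 3 then 1 else 0)"
    proof -
      have "line_edges 0 (Suc l) = {}" by (simp add: line_edges_def)
      then show ?thesis using True by (simp add: betti_indep_empty)
    qed
    finally show ?thesis unfolding m .
  next
    case False
    \<comment> \<open>Now \<open>l + 3 \<le> ?m \<le> 2 * l + 1\<close> lies strictly between
      \<open>l + 2\<close> and \<open>2 * l + 3\<close>, consecutive lengths at which paths with
      windows of length \<open>l + 1\<close> have homology. The deletion is acyclic and the homology
      comes from the link.\<close>
    have "\<not> ((\<exists>q. j = int q * (int (Suc l) - 1) + int (Suc l) - 2 \<and> ?m = q * (Suc l + 1) + Suc l)
      \<or> (\<exists>q. j = int q * (int (Suc l) - 1) - 1 \<and> ?m = q * (Suc l + 1)))" for j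
    proof -
      have "?m \<noteq> q * (Suc l + 1) + Suc l" for q using step t False by (cases q) auto
      moreover have "?m \<noteq> q * (Suc l + 1)" for q
      proof -
        consider "q = 0" | "q = 1" | p where "q = Suc (Suc p)" by (metis One_nat_def nat.exhaust)
        then show ?thesis by cases (use step t False in auto)
      qed
      ultimately show ?thesis by blast
    qed
    then have "betti (path_complex ?m (Suc l)) j = 0" for j
      using betti_path[of "Suc l" ?m j] by simp
    then have "betti (cycle_complex (Suc ?m) (Suc l)) i
        = betti (cycle_complex (Suc ?m) (Suc l) - path_complex ?m (Suc l)) i"
      by (rule betti_eq_rel)
    also have "\<dots> = betti (cycle_complex ?m l) (i - 1)"
      using betti_rel_cycle[of ?m l i] betti_link_cycle[of t l "i - 1"] t step False by simp
    finally show ?thesis unfolding m using step.IH[of "i - 1"] by auto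
  qed
qed

section \<open>All cycles, and the theorem\<close>

lemma betti_cycle_periodic:
  assumes k: "1 \<le> k" and t: "t \<le> k"
  shows "betti (cycle_complex ((q + 1) * (k + 1) + t) k) i
    = betti (cycle_complex (k + 1 + t) k) (i - int q * (int k - 1))"
proof (induction q arbitrary: i)
  case (Suc q)
  have shorter: "(Suc q + 1) * (k + 1) + t - k - 1 = (q + 1) * (k + 1) + t" by simp
  have long: "2 * k + 1 \<le> (Suc q + 1) * (k + 1) + t" by simp
  have "betti (cycle_complex ((Suc q + 1) * (k + 1) + t) k) i
      = betti (cycle_complex ((q + 1) * (k + 1) + t) k) (i + 1 - int k)"
    using betti_cycle_step[OF k long, of i] unfolding shorter .
  also have "\<dots> = betti (cycle_complex (k + 1 + t) k) (i + 1 - int k - int q * (int k - 1))"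
    by (rule Suc)
  also have "i + 1 - int k - int q * (int k - 1) = i - int (Suc q) * (int k - 1)"
    by (simp add: algebra_simps)
  finally show ?case .
qed simp

text \<open>Division of \<open>n\<close> by \<open>k + 1\<close> determines \<open>q\<close> and
  \<open>t\<close>, which collapses the existential conditions to one equation for \<open>i\<close>.
  Remainder \<open>0\<close> leads down to the cycle on \<open>k + 1\<close> vertices, a positive
  remainder to one on \<open>k + 1 + t\<close> vertices.\<close>

lemma betti_cycle:
  assumes k: "1 \<le> k" and n: "k < n"
  shows "betti (cycle_complex n k) i =
    (if \<exists>q. i = int q * (int k - 1) + int k - 2 \<and> n = (q + 1) * (k + 1) then real k
     else if \<exists>q. \<exists>t\<in>{1..k}. i = int q * (int k - 1) + int k + int t - 3 \<and> n = (q + 1) * (k + 1) + t then 1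
     else 0)" (is "_ = (if ?A then _ else if ?B then _ else _)")
proof -
  \<comment> \<open>The quotient is at least \<open>1\<close> because \<open>n > k\<close>, so the
    subtraction does not truncate; it accounts for the factor \<open>q + 1\<close> in the
    statement.\<close>
  define q where "q = n div (k + 1) - 1"
  define t where "t = n mod (k + 1)"
  have t: "t \<le> k" by (simp add: t_def less_Suc_eq_le[symmetric])
  have "n div (k + 1) \<ge> 1" using n by (simp add: div_greater_zero_iff Suc_le_eq)
  then have n_eq: "n = (q + 1) * (k + 1) + t"
    unfolding q_def t_def by (metis div_mult_mod_eq le_add_diff_inverse2)
  have uniq: "p = q \<and> u = t" if "n = (p + 1) * (k + 1) + u" "u \<le> k" for p u
  proof -
    have "n div (k + 1) = p + 1" "n mod (k + 1) = u"
      using that by (simp_all add: div_mult_self1_is_m less_Suc_eq_le mult.commute del: mult_Suc mult_Suc_right)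
    then show ?thesis by (simp add: q_def t_def)
  qed
  show ?thesis
  proof (cases "t = 0")
    case True
    have A: "?A \<longleftrightarrow> i = int q * (int k - 1) + int k - 2"
      using uniq[of _ 0] n_eq True by auto
    have B: "\<not> ?B" using uniq True by fastforce
    have val: "betti (cycle_complex n k) i = (if i = int q * (int k - 1) + int k - 2 then real k else 0)"
      using betti_cycle_periodic[OF k t, of q i] betti_cycle_minimal[OF k, of "i - int q * (int k - 1)"] True n_eq
      by (simp add: algebra_simps)
    show ?thesis by (simp only: A B val if_False)
  next
    case False
    have A: "\<not> ?A" using uniq[of _ 0] False by auto
    have B: "?B \<longleftrightarrow> i = int q * (int k - 1) + int k + int t - 3"
    proof
      assume ?B
      then obtain p u where "u \<in> {1..k}" "i = int p * (int k - 1) + int k + int u - 3" "n = (p + 1) * (k + 1) + u"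
        by blast
      then show "i = int q * (int k - 1) + int k + int t - 3" using uniq[of p u] by simp
    next
      assume "i = int q * (int k - 1) + int k + int t - 3"
      then show ?B using n_eq t False by (intro exI[of _ q] bexI[of _ t]) auto
    qed
    have val: "betti (cycle_complex n k) i = (if i = int q * (int k - 1) + int k + int t - 3 then 1 else 0)"
      using betti_cycle_periodic[OF k t, of q i] betti_cycle_short[of t k "i - int q * (int k - 1)"] t False n_eq
      by (simp add: algebra_simps)
    show ?thesis by (simp only: A B val if_False)
  qed
qed

theorem theorem3p1:
  fixes k n :: nat and i :: int
  assumes "k \<ge> 1" and "n \<ge> 1"
  shows "reduced_betti (indep_complex (tight_path n k)) i =
      (if \<exists>q::nat. i = int q * (int k - 1) + int k - 2 \<and> n = q * (k + 1) + k then 1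
       else if \<exists>q::nat. i = int q * (int k - 1) + int k - 2 \<and> n = (q + 1) * (k + 1) then 1
       else 0)
    \<and> (n > k \<longrightarrow>
      reduced_betti (indep_complex (tight_cycle n k)) i =
      (if \<exists>q::nat. i = int q * (int k - 1) + int k - 2 \<and> n = (q + 1) * (k + 1) then k
       else if \<exists>q::nat. \<exists>t\<in>{1..k}. i = int q * (int k - 1) + int k + int t - 3
            \<and> n = (q + 1) * (k + 1) + t then 1
       else 0))"
proof (intro conjI impI)
  have "real (reduced_betti (indep_complex (tight_path n k)) i) = betti (path_complex n k) i"
    using reduced_betti_eq_betti[OF is_complex_indep_complex[OF is_hypergraph_tight_path[OF assms(1)]], of n i]
    by (simp add: betti_tight_path)
  \<comment> \<open>In \<open>betti_path\<close> the second family starts with the empty path at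
    \<open>q = 0\<close>; \<open>n \<ge> 1\<close> excludes it and permits the shift of
    \<open>q\<close> by one.\<close>
  moreover have "(\<exists>q. i = int q * (int k - 1) - 1 \<and> n = q * (k + 1)) \<longleftrightarrow>
      (\<exists>q. i = int q * (int k - 1) + int k - 2 \<and> n = (q + 1) * (k + 1))"
  proof
    assume "\<exists>q. i = int q * (int k - 1) - 1 \<and> n = q * (k + 1)"
    then obtain q where q: "i = int q * (int k - 1) - 1" "n = q * (k + 1)" by blast
    then obtain p where "q = Suc p" using assms(2) by (cases q) auto
    then have "i = int p * (int k - 1) + int k - 2 \<and> n = (p + 1) * (k + 1)"
      using q by (simp add: algebra_simps)
    then show "\<exists>q. i = int q * (int k - 1) + int k - 2 \<and> n = (q + 1) * (k + 1)" by blast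
  next
    assume "\<exists>q. i = int q * (int k - 1) + int k - 2 \<and> n = (q + 1) * (k + 1)"
    then obtain q where q: "i = int q * (int k - 1) + int k - 2" "n = (q + 1) * (k + 1)" by blast
    then have "i = int (q + 1) * (int k - 1) - 1" by (simp add: algebra_simps)
    then show "\<exists>q. i = int q * (int k - 1) - 1 \<and> n = q * (k + 1)" using q(2) by blast
  qed
  ultimately show "reduced_betti (indep_complex (tight_path n k)) i =
      (if \<exists>q::nat. i = int q * (int k - 1) + int k - 2 \<and> n = q * (k + 1) + k then 1
       else if \<exists>q::nat. i = int q * (int k - 1) + int k - 2 \<and> n = (q + 1) * (k + 1) then 1
       else 0)"
    unfolding betti_path[OF assms(1)] by (auto split: if_splits)
next
  assume n: "n > k"
  have "real (reduced_betti (indep_complex (tight_cycle n k)) i) = betti (cycle_complex n k) i"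
    using reduced_betti_eq_betti[OF is_complex_indep_complex[OF is_hypergraph_tight_cycle[OF assms(1)]], of n i]
      tight_cycle_eq[of k n] assms(1) n by simp
  also have "\<dots> = real
      (if \<exists>q::nat. i = int q * (int k - 1) + int k - 2 \<and> n = (q + 1) * (k + 1) then k
       else if \<exists>q::nat. \<exists>t\<in>{1..k}. i = int q * (int k - 1) + int k + int t - 3
            \<and> n = (q + 1) * (k + 1) + t then 1
       else 0)"
    unfolding betti_cycle[OF assms(1) n] by (simp only: if_distrib[of real] of_nat_1 of_nat_0)
  finally show "reduced_betti (indep_complex (tight_cycle n k)) i =
      (if \<exists>q::nat. i = int q * (int k - 1) + int k - 2 \<and> n = (q + 1) * (k + 1) then k
       else if \<exists>q::nat. \<exists>t\<in>{1..k}. i = int q * (int k - 1) + int k + int t - 3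
            \<and> n = (q + 1) * (k + 1) + t then 1
       else 0)"
    by (simp only: of_nat_eq_iff)
qed

end
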